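(* Consider oriented homogeneous site Bernoulli percolation on $\mathbb{Z}^d$, with critical point $\vec{p}^{\,s}_c(d)$. The two following statements hold. 1) If $d$ is even, then $\vec{p}^{\,s}_c(d) \leq 1-(1/4)^{2/d}$. 2) For any dimension $d \geq 2$, we have $\vec{p}^{\,s}_c(d+1) \leq \mathrm{Sol}\big(\vec{p}^{\,s}_c(d),(d+1)/d \big)$.
   Context: The graph $\mathbb{Z}^d$ ($d\ge 1$) has vertex set $\mathbb{Z}^d$ and edge set $E(\mathbb{Z}^d)$, the set of unordered pairs $\langle v,u\rangle$ with $v,u\in\mathbb{Z}^d$ and $|v-u|=1$. In site Bernoulli percolation with parameter $p\in[0,1]$, the vertices are independently open with probability $p$ and closed with probability $1-p$; $\mathbb{P}_p$ is the resulting product measure. Let $e_1,\dots,e_d$ be the positive unit vectors of $\mathbb{Z}^d$. A sequence of vertices $(x_0,\dots,x_n)$ is an oriented open path if all its vertices are open and $x_j-x_{j-1}\in\{e_1,\dots,e_d\}$ for each $j=1,\dots,n$. Let $\vec{\mathcal{C}}^{\,s}_0$ be the set of vertices $x$ for which there is an oriented open path from $0$ to $x$, $\vec{\theta}^{\,s}_d(p)=\mathbb{P}_p(|\vec{\mathcal{C}}^{\,s}_0|=\infty)$, and $\vec{p}^{\,s}_c(d)=\sup\{p\in[0,1]:\vec{\theta}^{\,s}_d(p)=0\}$. For real numbers $a\in(0,1)$ and $b>1$, $\mathrm{Sol}(a,b)$ denotes the unique solution of $x=a[x+(1-x)^b]$ in the interval $(0,1)$. *)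

theory Defs
  imports "HOL-Probability.Probability"
begin

(* Since dimensions d and d + 1 have to be compared, the dimension is a natural number:
   a vertex of Z^d is an integer sequence that vanishes from index d on. *)
definition Zd :: "nat \<Rightarrow> (nat \<Rightarrow> int) set" where
  "Zd d = {x. \<forall>i\<ge>d. x i = 0}"

definition origin :: "nat \<Rightarrow> int" where
  "origin = (\<lambda>i. 0)"

definition unit_vec :: "nat \<Rightarrow> nat \<Rightarrow> int" where
  "unit_vec k = (\<lambda>i. if i = k then 1 else 0)"

(* A configuration maps a vertex to True if it is open and to False if it is closed. *)
definition site_percolation :: "nat \<Rightarrow> real \<Rightarrow> ((nat \<Rightarrow> int) \<Rightarrow> bool) measure" where
  "site_percolation d p = PiM (Zd d) (\<lambda>_. measure_pmf (bernoulli_pmf p))"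

(* The list [x_0, ..., x_n] has length n + 1; a single open vertex is a path (n = 0). *)
definition oriented_open_path ::
  "nat \<Rightarrow> ((nat \<Rightarrow> int) \<Rightarrow> bool) \<Rightarrow> (nat \<Rightarrow> int) list \<Rightarrow> bool" where
  "oriented_open_path d \<omega> xs \<longleftrightarrow>
     xs \<noteq> [] \<and> set xs \<subseteq> Zd d \<and> (\<forall>x\<in>set xs. \<omega> x) \<and>
     (\<forall>j\<in>{1..<length xs}. xs ! j - xs ! (j - 1) \<in> unit_vec ` {..<d})"

definition oriented_cluster ::
  "nat \<Rightarrow> ((nat \<Rightarrow> int) \<Rightarrow> bool) \<Rightarrow> (nat \<Rightarrow> int) set" where
  "oriented_cluster d \<omega> =
     {x. \<exists>xs. oriented_open_path d \<omega> xs \<and> hd xs = origin \<and> last xs = x}"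

definition theta_site :: "nat \<Rightarrow> real \<Rightarrow> real" where
  "theta_site d p =
     measure (site_percolation d p)
       {\<omega> \<in> space (site_percolation d p). infinite (oriented_cluster d \<omega>)}"

definition pc_site :: "nat \<Rightarrow> real" where
  "pc_site d = Sup {p \<in> {0..1}. theta_site d p = 0}"

(* Meaningful for 0 < a < 1 and b > 1, where the solution exists and is unique. *)
definition Sol :: "real \<Rightarrow> real \<Rightarrow> real" where
  "Sol a b = (THE x. x \<in> {0<..<1} \<and> x = a * (x + (1 - x) powr b))"

end

theory Submission
  imports Defs
begin

text \<open>
  Every vertex is read at most once in an exploration of the cluster, so an oriented cluster in a high dimension
  can be compared with a Markov chain of random subsets in a lower one.

  For even \<open>d = 2k\<close>, project onto the sum of the first \<open>k\<close> coordinates: each of the two children of a wet site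
  is offered \<open>k\<close> fresh vertices, so the projection dominates oriented percolation on \<open>\<int>\<^sup>2\<close> with parameter
  \<open>1 - (1 - p)\<^sup>k\<close>, and it remains to treat the plane at 3/4. There, as in the work of Holley and Liggett, the
  function \<open>h A = P(B \<inter> A \<noteq> {})\<close> is subharmonic for a suitable stationary renewal set \<open>B\<close>, whose gap law is forced
  by equality on intervals and exists because \<open>p \<ge> 3/4\<close>. One has to show
  that a thinned and doubled copy of \<open>B\<close> avoids \<open>A\<close> with at most the probability of \<open>B\<close>. Interpolate between
  the two processes by switching from the one to the other at a cut; moving the cut by one site changes the
  probability by a product of two increments, of the void probability to the left and of the one to the right,
  and both have the right sign because both gap laws have a decreasing failure rate.

  From \<open>d\<close> to \<open>d + 1\<close>, split every vertex into \<open>d\<close> independent vertices, one for each direction of \<open>\<int>\<^sup>d\<close>, open with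
  probability \<open>r = 1 - (1 - p) powr (1/d)\<close>. A child in direction \<open>i\<close> is searched again one level higher as long as
  the \<open>i\<close>-part of the column above the parent is open; it is found with probability
  \<open>p / (1 - (1 - p) * r) = p / (p + (1 - p) powr ((d + 1)/d))\<close>.
\<close>

text \<open>Write W and K for the generating functions of the gap tails of \<open>B\<close> and of
  its thinned copy at density p. Equality on intervals reads s W = p (K - 1 + s), and thinning reads
  1 / ((1 - s) K) = 1 - p + p / ((1 - s) W). Eliminating W leaves (1 - p) K^2 - (1 + (1 - p) (1 -
  s)) K + 1 = 0, whose discriminant at s = 1 is 4p - 3: this is where 3/4 comes from. At p = 3/4 the
  mean gaps K(1) = 2 and W(1) = 3/2 are finite, and 2/3, the density of \<open>B\<close>, bounds the
  survival from a single site uniformly in time; larger parameters follow by monotonicity.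

  The delicate point of a column search is that the set of sites it consumes is random. A search
  stops at its first success and leaves everything above that height unread, so that the child can
  later climb its own column through sites whose states are still independent of the past. The depth
  is truncated at a finite \<open>J\<close> to keep all expectations finite sums; the loss vanishes
  as \<open>J\<close> grows.\<close>

section \<open>Void probabilities of discrete renewal processes\<close>

text \<open>Renewal processes on the integers are encoded by \<open>t k\<close>, the conditional probability that the next site carries
  no point if the last point is followed by exactly \<open>k\<close> empty sites so far. \<open>renewal_void t k l\<close> is then the
  probability that the marked sites of \<open>l\<close> carry no point.\<close>
primrec renewal_void :: "(nat \<Rightarrow> real) \<Rightarrow> nat \<Rightarrow> bool list \<Rightarrow> real" where
  "renewal_void t k [] = 1"
| "renewal_void t k (b # l) =
     t k * renewal_void t (Suc k) l + (if b then 0 else (1 - t k) * renewal_void t 0 l)"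

text \<open>\<open>q\<close> is the probability that a point is deleted, so a point on a marked site
  is tolerated with weight \<open>q\<close>.\<close>

primrec thinned_void :: "(nat \<Rightarrow> real) \<Rightarrow> real \<Rightarrow> nat \<Rightarrow> bool list \<Rightarrow> real" where
  "thinned_void t q k [] = 1"
| "thinned_void t q k (b # l) =
     t k * thinned_void t q (Suc k) l + (if b then q else 1) * (1 - t k) * thinned_void t q 0 l"

text \<open>Offset \<open>n = 0\<close> is the very next site: \<open>renewal_prob t 0 n\<close> is
  the renewal density at distance \<open>n + 1\<close> from a point.\<close>

primrec renewal_prob :: "(nat \<Rightarrow> real) \<Rightarrow> nat \<Rightarrow> nat \<Rightarrow> real" where
  "renewal_prob t k 0 = 1 - t k"
| "renewal_prob t k (Suc n) = t k * renewal_prob t (Suc k) n + (1 - t k) * renewal_prob t 0 n"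

primrec surv_fun :: "(nat \<Rightarrow> real) \<Rightarrow> nat \<Rightarrow> real" where
  "surv_fun t 0 = 1"
| "surv_fun t (Suc n) = t n * surv_fun t n"

lemma renewal_void_bounds:
  assumes "\<And>k. 0 \<le> t k" "\<And>k. t k \<le> 1"
  shows "0 \<le> renewal_void t k l \<and> renewal_void t k l \<le> 1"
proof (induction l arbitrary: k)
  case (Cons b l)
  have "t k * renewal_void t (Suc k) l \<le> t k * 1"
    using Cons assms by (intro mult_left_mono) auto
  moreover have "(1 - t k) * renewal_void t 0 l \<le> (1 - t k) * 1"
    using Cons assms by (intro mult_left_mono) auto
  moreover have "0 \<le> t k * renewal_void t (Suc k) l" "0 \<le> (1 - t k) * renewal_void t 0 l"
    using Cons assms by auto
  ultimately show ?case using assms[of k] by auto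
qed auto

lemma renewal_void_nonneg:
  assumes "\<And>k. 0 \<le> t k" "\<And>k. t k \<le> 1"
  shows "0 \<le> renewal_void t k l"
  using renewal_void_bounds assms by blast

text \<open>A nondecreasing \<open>t\<close> is a decreasing failure rate: the older the last renewal, the fewer points
  follow.\<close>
lemma renewal_void_mono_age:
  assumes "\<And>k. 0 \<le> t k" "\<And>k. t k \<le> 1" "\<And>k. t k \<le> t (Suc k)"
  shows "renewal_void t k l \<le> renewal_void t (Suc k) l"
proof (induction l arbitrary: k)
  case (Cons b l)
  define c where "c = (if b then 0 else renewal_void t 0 l)"
  have "renewal_void t 0 l \<le> renewal_void t (Suc k) l"
    by (rule lift_Suc_mono_le[of "\<lambda>k. renewal_void t k l"]) (use Cons in auto)
  then have c: "c \<le> renewal_void t (Suc k) l"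
    using renewal_void_nonneg[OF assms(1,2)] by (auto simp: c_def)
  have 1: "t k * renewal_void t (Suc k) l + (1 - t k) * c \<le>
        t (Suc k) * renewal_void t (Suc k) l + (1 - t (Suc k)) * c"
  proof -
    have "0 \<le> (t (Suc k) - t k) * (renewal_void t (Suc k) l - c)"
      using c assms(3) by (intro mult_nonneg_nonneg) auto
    then show ?thesis by (simp add: algebra_simps)
  qed
  have 2: "t (Suc k) * renewal_void t (Suc k) l \<le> t (Suc k) * renewal_void t (Suc (Suc k)) l"
    using Cons assms by (intro mult_left_mono) auto
  have "renewal_void t k (b # l) = t k * renewal_void t (Suc k) l + (1 - t k) * c"
    "renewal_void t (Suc k) (b # l) = t (Suc k) * renewal_void t (Suc (Suc k)) l + (1 - t (Suc k)) * c"
    by (auto simp: c_def)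
  then show ?case using 1 2 by linarith
qed simp

text \<open>If the inserted site carries a point, nothing has changed; otherwise the age has grown.
  This gives the sign of both increments when the cut moves.\<close>

lemma renewal_void_shift:
  assumes "\<And>k. 0 \<le> t k" "\<And>k. t k \<le> 1" "\<And>k. t k \<le> t (Suc k)"
  shows "renewal_void t 0 l \<le> renewal_void t 0 (False # l)"
proof -
  have "renewal_void t 0 l \<le> renewal_void t (Suc 0) l"
    by (rule renewal_void_mono_age) (use assms in auto)
  then have "t 0 * renewal_void t 0 l \<le> t 0 * renewal_void t (Suc 0) l"
    using assms(1) by (intro mult_left_mono) auto
  then show ?thesis by (simp add: algebra_simps)
qed

lemma renewal_void_first_point:
  "surv_fun t i * renewal_void t i l = surv_fun t (i + length l) +
     (\<Sum>k<length l. (surv_fun t (i + k) - surv_fun t (Suc (i + k))) *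
        (if l ! k then 0 else renewal_void t 0 (drop (Suc k) l)))"
proof (induction l arbitrary: i)
  case (Cons b l)
  have "surv_fun t i * renewal_void t i (b # l) =
      surv_fun t (Suc i) * renewal_void t (Suc i) l +
      (surv_fun t i - surv_fun t (Suc i)) * (if b then 0 else renewal_void t 0 l)"
    by (simp add: algebra_simps)
  also have "\<dots> = surv_fun t (i + length (b # l)) +
     (\<Sum>k<length (b # l). (surv_fun t (i + k) - surv_fun t (Suc (i + k))) *
        (if (b # l) ! k then 0 else renewal_void t 0 (drop (Suc k) (b # l))))"
    unfolding Cons.IH length_Cons sum.lessThan_Suc_shift
    by (simp del: surv_fun.simps cong: if_cong)
  finally show ?case .
qed simp

text \<open>A hit is classified by the last marked site that carries a point; after it the process
  starts afresh. In this form void probabilities starting from a point depend on \<open>t\<close>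
  only through renewal densities.\<close>

lemma renewal_void_last_point:
  "renewal_void t k l =
     1 - (\<Sum>i<length l. if l ! i then renewal_prob t k i * renewal_void t 0 (drop (Suc i) l) else 0)"
proof (induction l arbitrary: k)
  case (Cons b l)
  let ?S = "\<lambda>k f. \<Sum>i<length l. if l ! i then renewal_prob t k (f i) * renewal_void t 0 (drop (Suc i) l) else 0"
  have S: "?S k Suc = t k * ?S (Suc k) (\<lambda>i. i) + (1 - t k) * ?S 0 (\<lambda>i. i)"
    by (auto simp: sum_distrib_left simp flip: sum.distrib intro!: sum.cong simp: algebra_simps)
  have 1: "renewal_void t (Suc k) l = 1 - ?S (Suc k) (\<lambda>i. i)" "renewal_void t 0 l = 1 - ?S 0 (\<lambda>i. i)"
    by (rule Cons.IH)+
  have "t k * renewal_void t (Suc k) l + (1 - t k) * renewal_void t 0 l = 1 - ?S k Suc"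
    unfolding S 1 by (simp add: algebra_simps)
  then show ?case
    unfolding length_Cons sum.lessThan_Suc_shift by (simp cong: if_cong)
qed simp

lemma thinned_void_last_point:
  "thinned_void t q k l =
     1 - (1 - q) * (\<Sum>i<length l. if l ! i then renewal_prob t k i * thinned_void t q 0 (drop (Suc i) l) else 0)"
proof (induction l arbitrary: k)
  case (Cons b l)
  let ?S = "\<lambda>k f. \<Sum>i<length l. if l ! i then renewal_prob t k (f i) * thinned_void t q 0 (drop (Suc i) l) else 0"
  have S: "?S k Suc = t k * ?S (Suc k) (\<lambda>i. i) + (1 - t k) * ?S 0 (\<lambda>i. i)"
    by (auto simp: sum_distrib_left simp flip: sum.distrib intro!: sum.cong simp: algebra_simps)
  have 1: "thinned_void t q (Suc k) l = 1 - (1 - q) * ?S (Suc k) (\<lambda>i. i)"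
     "thinned_void t q 0 l = 1 - (1 - q) * ?S 0 (\<lambda>i. i)"
    by (rule Cons.IH)+
  have "t k * thinned_void t q (Suc k) l + (1 - t k) * thinned_void t q 0 l = 1 - (1 - q) * ?S k Suc"
    unfolding S 1 by (simp add: algebra_simps)
  then show ?case
    unfolding length_Cons sum.lessThan_Suc_shift by (auto simp: algebra_simps cong: if_cong)
qed simp

section \<open>Stationary renewal processes and their thinning\<close>

text \<open>The stationary delay is not normalised: \<open>\<theta> - (\<Sum>k<j. surv_fun t k)\<close> is the weight of having seen no
  point on the first \<open>j\<close> sites, and every site carries a point with weight 1.\<close>
primrec stat_void :: "(nat \<Rightarrow> real) \<Rightarrow> real \<Rightarrow> nat \<Rightarrow> bool list \<Rightarrow> real" where
  "stat_void t \<theta> j [] = \<theta> - (\<Sum>k<j. surv_fun t k)"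
| "stat_void t \<theta> j (b # l) =
     stat_void t \<theta> (Suc j) l + (if b then 0 else surv_fun t j * renewal_void t 0 l)"

primrec stat_thinned_void :: "(nat \<Rightarrow> real) \<Rightarrow> real \<Rightarrow> real \<Rightarrow> nat \<Rightarrow> bool list \<Rightarrow> real" where
  "stat_thinned_void t \<theta> q j [] = \<theta> - (\<Sum>k<j. surv_fun t k)"
| "stat_thinned_void t \<theta> q j (b # l) =
     stat_thinned_void t \<theta> q (Suc j) l + (if b then q else 1) * surv_fun t j * thinned_void t q 0 l"

primrec stat_prob :: "(nat \<Rightarrow> real) \<Rightarrow> nat \<Rightarrow> nat \<Rightarrow> real" where
  "stat_prob t j 0 = surv_fun t j"
| "stat_prob t j (Suc n) = stat_prob t (Suc j) n + surv_fun t j * renewal_prob t 0 n"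

text \<open>In the stationary process age \<open>k\<close> has weight \<open>surv_fun t k\<close>,
  and \<open>stat_prob t j\<close> stands for the contribution of all ages from \<open>j\<close> on.
  Adding the ages below \<open>j\<close> must give the same total for every \<open>j\<close>; this
  states stationarity without infinite series.\<close>

lemma stat_prob_aux: "stat_prob t j n + (\<Sum>k<j. surv_fun t k * renewal_prob t k n) = 1"
proof (induction n arbitrary: j)
  case 0
  have "(\<Sum>k<j. surv_fun t k * renewal_prob t k 0) = (\<Sum>k<j. surv_fun t k - surv_fun t (Suc k))"
    by (intro sum.cong) (auto simp: algebra_simps)
  also have "\<dots> = 1 - surv_fun t j" by (subst sum_lessThan_telescope') simp
  finally show ?case by simp
next
  case (Suc n)
  have "(\<Sum>k<j. surv_fun t k * renewal_prob t k (Suc n)) =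
     (\<Sum>k<j. surv_fun t (Suc k) * renewal_prob t (Suc k) n) +
     (\<Sum>k<j. surv_fun t k - surv_fun t (Suc k)) * renewal_prob t 0 n"
    unfolding sum_distrib_right sum.distrib[symmetric]
    by (intro sum.cong) (auto simp: algebra_simps)
  also have "(\<Sum>k<j. surv_fun t k - surv_fun t (Suc k)) = 1 - surv_fun t j"
    by (subst sum_lessThan_telescope') simp
  finally have "(\<Sum>k<j. surv_fun t k * renewal_prob t k (Suc n)) + surv_fun t j * renewal_prob t 0 n =
     (\<Sum>k<Suc j. surv_fun t k * renewal_prob t k n)"
    unfolding sum.lessThan_Suc_shift by (simp add: algebra_simps del: surv_fun.simps(2))
  then show ?case using Suc[of "Suc j"] by simp
qed

lemma stat_prob_0: "stat_prob t 0 n = 1"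
  using stat_prob_aux[of t 0 n] by simp

lemma stat_void_last_point:
  "stat_void t \<theta> j l = \<theta> - (\<Sum>k<j. surv_fun t k) -
     (\<Sum>i<length l. if l ! i then stat_prob t j i * renewal_void t 0 (drop (Suc i) l) else 0)"
proof (induction l arbitrary: j)
  case (Cons b l)
  let ?S = "\<lambda>k f. \<Sum>i<length l. if l ! i then stat_prob t k (f i) * renewal_void t 0 (drop (Suc i) l) else 0"
  let ?R = "\<Sum>i<length l. if l ! i then renewal_prob t 0 i * renewal_void t 0 (drop (Suc i) l) else 0"
  have S: "?S j Suc = ?S (Suc j) (\<lambda>i. i) + surv_fun t j * ?R"
    by (auto simp: sum_distrib_left simp flip: sum.distrib intro!: sum.cong simp: algebra_simps)
  have 1: "stat_void t \<theta> (Suc j) l = \<theta> - (\<Sum>k<Suc j. surv_fun t k) - ?S (Suc j) (\<lambda>i. i)"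
     "renewal_void t 0 l = 1 - ?R"
    by (rule Cons.IH renewal_void_last_point)+
  have "stat_void t \<theta> (Suc j) l + surv_fun t j * renewal_void t 0 l = \<theta> - (\<Sum>k<j. surv_fun t k) - ?S j Suc"
    unfolding S 1 by (simp add: algebra_simps)
  then show ?case
    unfolding length_Cons sum.lessThan_Suc_shift by (simp cong: if_cong)
qed simp

lemma stat_thinned_void_last_point:
  "stat_thinned_void t \<theta> q j l = \<theta> - (\<Sum>k<j. surv_fun t k) -
     (1 - q) * (\<Sum>i<length l. if l ! i then stat_prob t j i * thinned_void t q 0 (drop (Suc i) l) else 0)"
proof (induction l arbitrary: j)
  case (Cons b l)
  let ?S = "\<lambda>k f. \<Sum>i<length l. if l ! i then stat_prob t k (f i) * thinned_void t q 0 (drop (Suc i) l) else 0"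
  let ?R = "\<Sum>i<length l. if l ! i then renewal_prob t 0 i * thinned_void t q 0 (drop (Suc i) l) else 0"
  have S: "?S j Suc = ?S (Suc j) (\<lambda>i. i) + surv_fun t j * ?R"
    by (auto simp: sum_distrib_left simp flip: sum.distrib intro!: sum.cong simp: algebra_simps)
  have 1: "stat_thinned_void t \<theta> q (Suc j) l = \<theta> - (\<Sum>k<Suc j. surv_fun t k) - (1 - q) * ?S (Suc j) (\<lambda>i. i)"
     "thinned_void t q 0 l = 1 - (1 - q) * ?R"
    by (rule Cons.IH thinned_void_last_point)+
  have "stat_thinned_void t \<theta> q (Suc j) l + surv_fun t j * thinned_void t q 0 l =
     \<theta> - (\<Sum>k<j. surv_fun t k) - (1 - q) * ?S j Suc"
    unfolding S 1 by (simp add: algebra_simps)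
  then show ?case
    unfolding length_Cons sum.lessThan_Suc_shift by (auto simp: algebra_simps cong: if_cong)
qed simp

text \<open>Thinning multiplies renewal densities by \<open>1 - q\<close>, and by the decomposition
  at the last hit the densities determine all void probabilities.\<close>

lemma thinned_void_eq:
  assumes "\<And>n. renewal_prob t' 0 n = (1 - q) * renewal_prob t 0 n"
  shows "thinned_void t q 0 l = renewal_void t' 0 l"
proof (induction "length l" arbitrary: l rule: less_induct)
  case less
  have "(1 - q) * (\<Sum>i<length l. if l ! i then renewal_prob t 0 i * thinned_void t q 0 (drop (Suc i) l) else 0) =
     (\<Sum>i<length l. if l ! i then renewal_prob t' 0 i * renewal_void t' 0 (drop (Suc i) l) else 0)"
    unfolding sum_distrib_left by (intro sum.cong) (auto simp: less assms)
  then show ?case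
    using thinned_void_last_point[of t q 0 l] renewal_void_last_point[of t' 0 l] by simp
qed

lemma stat_thinned_void_eq:
  assumes "\<And>n. renewal_prob t' 0 n = (1 - q) * renewal_prob t 0 n" and "\<theta> = (1 - q) * \<theta>'"
  shows "stat_thinned_void t \<theta> q 0 l = (1 - q) * stat_void t' \<theta>' 0 l"
  unfolding stat_thinned_void_last_point stat_void_last_point stat_prob_0
    thinned_void_eq[OF assms(1)]
  by (simp add: assms(2) algebra_simps)

text \<open>The renewal equation started at age \<open>k\<close>: the first point is the target
  itself or lies at an offset \<open>i < n\<close>.\<close>

lemma surv_fun_renewal_prob:
  "surv_fun t k * renewal_prob t k n =
    (surv_fun t (k + n) - surv_fun t (Suc (k + n))) +
    (\<Sum>i<n. (surv_fun t (k + i) - surv_fun t (Suc (k + i))) * renewal_prob t 0 (n - Suc i))"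
proof (induction n arbitrary: k)
  case (Suc n)
  have "surv_fun t k * renewal_prob t k (Suc n) =
    surv_fun t (Suc k) * renewal_prob t (Suc k) n + (surv_fun t k - surv_fun t (Suc k)) * renewal_prob t 0 n"
    by (simp add: algebra_simps)
  then show ?case unfolding Suc sum.lessThan_Suc_shift by (simp del: surv_fun.simps)
qed (simp add: algebra_simps)

section \<open>The gap distributions at density 3/4\<close>

text \<open>\<open>K n = surv_fun thin_ratio n\<close> has the generating function \<open>(5 - s - sqrt ((1 - s) * (9 - s))) / 2\<close>, and the
  recursion is the one of its coefficients. The law of \<open>gap_ratio\<close> gives \<open>thin_ratio\<close> when each point is kept with
  probability 3/4.\<close>
primrec thin_ratio :: "nat \<Rightarrow> real" where
  "thin_ratio 0 = 1 / 3"
| "thin_ratio (Suc n) = (5 * (2 * real n + 1) - (real n - 1) / thin_ratio n) / (9 * (real n + 2))"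

definition gap_ratio :: "nat \<Rightarrow> real" where
  "gap_ratio k = (if k = 0 then thin_ratio 1 / 4 else thin_ratio (Suc k))"

text \<open>The recursion is decreasing in \<open>1 / thin_ratio n\<close>, so an increase of the
  ratio is passed on; the explicit dependence on \<open>n\<close> also acts upwards as long as the
  ratio stays above 1/3. Bounds and monotonicity therefore go through one induction.\<close>

lemma thin_ratio_aux: "1 / 3 \<le> thin_ratio n \<and> thin_ratio n \<le> 1 \<and> thin_ratio n \<le> thin_ratio (Suc n)"
proof (induction n)
  case 0
  show ?case by simp
next
  case (Suc n)
  show ?case
  \<comment> \<open>At \<open>n = 0\<close> the coefficient \<open>real n - 1\<close> is negative,
    which reverses the estimate behind the upper bound.\<close>
  proof (cases "n = 0")
    case True
    then show ?thesis by simp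
  next
    case False
    then have n: "real n \<ge> 1" by simp
    define y where "y = 1 / thin_ratio n"
    define y' where "y' = 1 / thin_ratio (Suc n)"
    have t: "1 / 3 \<le> thin_ratio n" "thin_ratio n \<le> 1" "thin_ratio n \<le> thin_ratio (Suc n)" using Suc by auto
    have y: "1 \<le> y" "y \<le> 3" "y' \<le> y"
      using t frac_le[of 1 1 "thin_ratio n" "thin_ratio (Suc n)"] by (auto simp: y_def y'_def divide_simps simp del: thin_ratio.simps)
    have e1: "thin_ratio (Suc n) = (5 * (2 * real n + 1) - (real n - 1) * y) / (9 * (real n + 2))"
      by (simp add: y_def)
    have e2: "thin_ratio (Suc (Suc n)) = (5 * (2 * real n + 3) - real n * y') / (9 * (real n + 3))"
      by (simp only: thin_ratio.simps(2)[of "Suc n"] y'_def) (simp add: algebra_simps)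
    have "(real n - 1) * 1 \<le> (real n - 1) * y"
      using n y by (intro mult_left_mono) auto
    then have b: "thin_ratio (Suc n) \<le> 1"
      unfolding e1 using n by (simp add: field_simps)
    have "real n * y' \<le> real n * y" using y by (intro mult_left_mono) auto
    then have "(5 * (2 * real n + 3) - real n * y) / (9 * (real n + 3)) \<le> thin_ratio (Suc (Suc n))"
      unfolding e2 by (intro divide_right_mono) auto
    moreover have "thin_ratio (Suc n) \<le> (5 * (2 * real n + 3) - real n * y) / (9 * (real n + 3))"
    proof -
      \<comment> \<open>The right-hand side exceeds the left-hand side by
        \<open>9 * (15 - 3 * y)\<close>.\<close>
      have "(5 * (2 * real n + 1) - (real n - 1) * y) * (9 * (real n + 3)) \<le>
          (5 * (2 * real n + 3) - real n * y) * (9 * (real n + 2))"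
        using y(2) by (simp add: algebra_simps)
      moreover have "a / b \<le> c / d" if "a * d \<le> c * b" "0 < b" "0 < d" for a b c d :: real
        using that by (simp add: divide_simps mult.commute)
      ultimately show ?thesis unfolding e1 by simp
    qed
    ultimately show ?thesis using b t by linarith
  qed
qed

lemma thin_ratio_bounds: "1 / 3 \<le> thin_ratio n" "0 \<le> thin_ratio n" "thin_ratio n \<le> 1" "thin_ratio n \<le> thin_ratio (Suc n)"
  using thin_ratio_aux[of n] by linarith+

lemma gap_ratio_bounds: "0 \<le> gap_ratio k" "gap_ratio k \<le> 1" "gap_ratio k \<le> gap_ratio (Suc k)"
  using thin_ratio_bounds[of "Suc k"] thin_ratio_bounds[of "Suc (Suc k)"] by (auto simp: gap_ratio_def)

lemma surv_fun_gap_ratio: "surv_fun gap_ratio (Suc k) = 3 / 4 * surv_fun thin_ratio (Suc (Suc k))"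
  by (induction k) (auto simp: gap_ratio_def simp del: thin_ratio.simps(2))

lemma surv_fun_thin_ratio_rec:
  "9 * (real n + 2) * surv_fun thin_ratio (Suc (Suc n)) =
     5 * (2 * real n + 1) * surv_fun thin_ratio (Suc n) - (real n - 1) * surv_fun thin_ratio n"
proof -
  have "thin_ratio n \<noteq> 0" using thin_ratio_bounds(1)[of n] by linarith
  moreover have "9 * (real n + 2) * thin_ratio (Suc n) = 5 * (2 * real n + 1) - (real n - 1) / thin_ratio n"
    by simp
  moreover from calculation have "(real n - 1) / thin_ratio n * thin_ratio n = real n - 1" by simp
  ultimately have "9 * (real n + 2) * thin_ratio (Suc n) * thin_ratio n = 5 * (2 * real n + 1) * thin_ratio n - (real n - 1)"
    by (simp only: left_diff_distrib)
  from arg_cong[OF this, of "\<lambda>x. x * surv_fun thin_ratio n"] show ?thesis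
    by (simp add: algebra_simps del: thin_ratio.simps)
qed

lemma surv_fun_thin_ratio_nonneg: "0 \<le> surv_fun thin_ratio n"
  by (induction n) (auto simp: thin_ratio_bounds simp del: thin_ratio.simps)

text \<open>When the coefficient recursion is summed, \<open>surv_fun thin_ratio m\<close> collects
  9m - 5(2m - 1) + (m - 1) = 4, whatever \<open>m\<close> is; only boundary terms remain.\<close>

lemma sum_surv_fun_thin_ratio:
  "4 * (\<Sum>k<Suc m. surv_fun thin_ratio k) = 8 + (real m - 1) * surv_fun thin_ratio m - 9 * (real m + 1) * surv_fun thin_ratio (Suc m)"
proof (induction m)
  case (Suc m)
  have "4 * (\<Sum>k<Suc (Suc m). surv_fun thin_ratio k) = 4 * (\<Sum>k<Suc m. surv_fun thin_ratio k) + 4 * surv_fun thin_ratio (Suc m)"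
    by simp
  then show ?case unfolding Suc using surv_fun_thin_ratio_rec[of m]
    by (simp add: algebra_simps del: surv_fun.simps)
qed simp

text \<open>The boundary terms are nonpositive because the ratios are at least 1/3. The bound 2 is
  the value of the generating function at s = 1; it makes stationary weights nonnegative.\<close>

lemma sum_surv_fun_thin_ratio_le: "(\<Sum>k<n. surv_fun thin_ratio k) \<le> 2"
proof (cases n)
  case (Suc m)
  have "(real m + 1) * (1 / 3 * surv_fun thin_ratio m) \<le> (real m + 1) * surv_fun thin_ratio (Suc m)"
    unfolding surv_fun.simps
    using thin_ratio_bounds surv_fun_thin_ratio_nonneg by (intro mult_left_mono mult_right_mono) auto
  then have "(real m - 1) * surv_fun thin_ratio m - 9 * (real m + 1) * surv_fun thin_ratio (Suc m) \<le>
      (real m - 1) * surv_fun thin_ratio m - 3 * (real m + 1) * surv_fun thin_ratio m"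
    by (simp del: surv_fun.simps add: algebra_simps)
  also have "\<dots> = - (2 * real m + 4) * surv_fun thin_ratio m" by (simp add: algebra_simps)
  also have "\<dots> \<le> 0" using surv_fun_thin_ratio_nonneg[of m] by (intro mult_nonpos_nonneg) auto
  finally show ?thesis using sum_surv_fun_thin_ratio[of m] unfolding Suc by linarith
qed simp

text \<open>This is the equality on intervals that dictates the gap law: a nonempty interval and its
  neighbourhood, one site longer, have the same void weight for the two processes.\<close>

lemma sum_surv_fun_gap_ratio: "(\<Sum>k<Suc j. surv_fun gap_ratio k) = 3 / 4 * (\<Sum>k<Suc (Suc j). surv_fun thin_ratio k)"
  by (induction j) (auto simp: surv_fun_gap_ratio algebra_simps simp del: surv_fun.simps(2)
    simp add: surv_fun.simps(2)[of thin_ratio 0])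

lemma sum_surv_fun_gap_ratio_le: "(\<Sum>k<j. surv_fun gap_ratio k) \<le> 3 / 2"
proof (cases j)
  case (Suc i)
  then show ?thesis using sum_surv_fun_gap_ratio[of i] sum_surv_fun_thin_ratio_le[of "Suc (Suc i)"] by simp
qed simp

text \<open>The first two factors multiply to 1 minus the generating function of the gap; the last
  one is the renewal series, whose leading 1 is the starting point.\<close>

lemma fps_surv_fun_renewal_prob:
  fixes t :: "nat \<Rightarrow> real"
  shows "(1 - fps_X) * Abs_fps (surv_fun t) * (1 + fps_X * Abs_fps (renewal_prob t 0)) = 1"
proof -
  define S where "S = Abs_fps (surv_fun t)"
  define R where "R = Abs_fps (renewal_prob t 0)"
  define F where "F = Abs_fps (\<lambda>n. surv_fun t n - surv_fun t (Suc n))"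
  have F: "fps_X * F = 1 - (1 - fps_X) * S"
  proof (rule fps_ext)
    fix n show "fps_nth (fps_X * F) n = fps_nth (1 - (1 - fps_X) * S) n"
      by (cases n) (auto simp: F_def S_def algebra_simps simp del: surv_fun.simps(2))
  qed
  have R: "R = F + fps_X * (F * R)"
  proof (rule fps_ext)
    fix n
    show "fps_nth R n = fps_nth (F + fps_X * (F * R)) n"
    proof (cases n)
      case (Suc m)
      have "fps_nth (F * R) m = (\<Sum>i<n. (surv_fun t i - surv_fun t (Suc i)) * renewal_prob t 0 (n - Suc i))"
        unfolding fps_mult_nth Suc lessThan_Suc_atMost atLeast0AtMost
        by (intro sum.cong) (auto simp: F_def R_def)
      then show ?thesis
        using surv_fun_renewal_prob[of t 0 n] Suc by (simp add: F_def R_def del: surv_fun.simps(2) renewal_prob.simps)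
    qed (simp add: F_def R_def)
  qed
  define U where "U = 1 + fps_X * R"
  have "U - 1 = fps_X * F * U"
    unfolding U_def by (subst R) (simp add: algebra_simps)
  then have "(1 - fps_X) * S * U = 1" unfolding F by (simp add: algebra_simps)
  then show ?thesis by (simp add: U_def S_def R_def)
qed

text \<open>A square root \<open>Z\<close> of a polynomial \<open>D\<close> satisfies 2 D Z' = D' Z,
  which in coefficients is the recursion of \<open>thin_ratio\<close>. Conversely this equation
  forces Z^2 / D to have derivative zero, and its constant term is 1.\<close>

lemma fps_quadratic_thin_ratio:
  "(2 * Abs_fps (surv_fun thin_ratio) - 5 + fps_X)\<^sup>2 = 9 - 10 * fps_X + fps_X\<^sup>2"
proof -
  define Z where "Z = 2 * Abs_fps (surv_fun thin_ratio) - 5 + fps_X"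
  define D where "D = (9 - 10 * fps_X + fps_X\<^sup>2 :: real fps)"
  have Z: "fps_nth Z n = (if n = 0 then - 3 else if n = 1 then 5 / 3 else 2 * surv_fun thin_ratio n)" for n
    by (auto simp: Z_def numeral_fps_const fps_X_def)
  have ode: "D * fps_deriv Z = (fps_X - 5) * Z"
  proof (rule fps_ext)
    fix n
    have E: "D * fps_deriv Z = fps_const 9 * fps_deriv Z - fps_const 10 * (fps_X * fps_deriv Z) +
        fps_X * (fps_X * fps_deriv Z)"
      by (simp add: D_def algebra_simps power2_eq_square numeral_fps_const)
    have l: "fps_nth (D * fps_deriv Z) n = 9 * (real n + 1) * fps_nth Z (n + 1) - 10 * real n * fps_nth Z n +
       (if n = 0 then 0 else (real n - 1) * fps_nth Z (n - 1))"
      unfolding E by (cases n; cases "n - 1") (auto simp: algebra_simps)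
    have "(fps_X - 5) * Z = fps_X * Z - fps_const 5 * Z"
      by (simp add: algebra_simps numeral_fps_const)
    then have r: "fps_nth ((fps_X - 5) * Z) n = (if n = 0 then 0 else fps_nth Z (n - 1)) - 5 * fps_nth Z n"
      by simp
    consider "n = 0" | "n = 1" | "n = 2" | m where "n = Suc (Suc (Suc m))"
      by (metis One_nat_def numeral_2_eq_2 not0_implies_Suc)
    then show "fps_nth (D * fps_deriv Z) n = fps_nth ((fps_X - 5) * Z) n"
    proof cases
      case 3
      then show ?thesis unfolding l r using surv_fun_thin_ratio_rec[of 1] by (simp add: Z numeral_eq_Suc)
    next
      case 4
      then show ?thesis unfolding l r using surv_fun_thin_ratio_rec[of "Suc (Suc m)"]
        by (simp add: Z algebra_simps del: surv_fun.simps)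
    next
      case 1
      then show ?thesis unfolding l r by (simp add: Z)
    next
      case 2
      then show ?thesis unfolding l r by (simp add: Z numeral_eq_Suc)
    qed
  qed
  have D0: "fps_nth D 0 = 9" by (simp add: D_def numeral_fps_const power2_eq_square)
  then have Dnz: "D \<noteq> 0" by auto
  define Q where "Q = Z\<^sup>2 * inverse D"
  have QD: "Q * D = Z\<^sup>2"
    using D0 by (simp add: Q_def mult.assoc inverse_mult_eq_1)
  have dD: "fps_deriv D = 2 * (fps_X - 5)"
    by (simp add: D_def fps_deriv_power numeral_fps_const algebra_simps)
  have "D * fps_deriv (Q * D) = fps_deriv D * (Q * D)"
  proof -
    have "D * fps_deriv (Z\<^sup>2) = 2 * Z * (D * fps_deriv Z)"
      by (simp add: power2_eq_square algebra_simps)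
    then show ?thesis unfolding QD dD ode by (simp add: power2_eq_square algebra_simps)
  qed
  then have "D * (D * fps_deriv Q) = 0" by (simp add: algebra_simps)
  then have "fps_deriv Q = 0" using Dnz by simp
  then have "Q = fps_const (fps_nth Q 0)" by (simp add: fps_deriv_eq_0_iff)
  moreover have "fps_nth Q 0 = 1"
    using arg_cong[OF QD, of "\<lambda>f. fps_nth f 0"] D0 by (simp add: Z power2_eq_square)
  ultimately have "Q = 1" by simp
  then show ?thesis using QD by (simp add: Z_def D_def)
qed

text \<open>The claim amounts to \<open>1 + 3 * Us = 4 * Ut\<close>. Expressed through the tails it
  becomes a multiple of the quadratic equation for \<open>k\<close>.\<close>

lemma renewal_prob_thin_ratio: "renewal_prob thin_ratio 0 n = 3 / 4 * renewal_prob gap_ratio 0 n"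
proof -
  define k where "k = Abs_fps (surv_fun thin_ratio)"
  define w where "w = Abs_fps (surv_fun gap_ratio)"
  define Ut where "Ut = 1 + fps_X * Abs_fps (renewal_prob thin_ratio 0)"
  define Us where "Us = 1 + fps_X * Abs_fps (renewal_prob gap_ratio 0)"
  have t: "(1 - fps_X) * k * Ut = 1" and s: "(1 - fps_X) * w * Us = 1"
    unfolding k_def w_def Ut_def Us_def by (rule fps_surv_fun_renewal_prob)+
  have nz: "(1 - fps_X) * k * w \<noteq> 0" using t s by auto
  \<comment> \<open>The summand \<open>fps_X\<close> accounts for
    \<open>surv_fun gap_ratio 0 = 1\<close>, where the proportionality of the tails would give only
    1/4.\<close>
  have w: "4 * (fps_X * w) = 3 * (k - 1 + fps_X)"
  proof (rule fps_ext)
    fix n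
    show "fps_nth (4 * (fps_X * w)) n = fps_nth (3 * (k - 1 + fps_X)) n"
      by (cases n; cases "n - 1") (auto simp: w_def k_def numeral_fps_const surv_fun_gap_ratio simp del: surv_fun.simps(2)
         simp add: surv_fun.simps(2)[of thin_ratio 0])
  qed
  have "4 * (k\<^sup>2 - 5 * k + fps_X * k + 4) = 0"
    using fps_quadratic_thin_ratio unfolding k_def[symmetric] by (simp add: power2_eq_square algebra_simps)
  then have q: "k\<^sup>2 - 5 * k + fps_X * k + 4 = 0"
    by (metis mult_eq_0_iff zero_neq_numeral)
  have "4 * fps_X * (k * (3 + (1 - fps_X) * w) - 4 * w) =
      12 * fps_X * k + (1 - fps_X) * k * (4 * (fps_X * w)) - 4 * (4 * (fps_X * w))"
    by (simp add: algebra_simps)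
  also have "\<dots> = 3 * (1 - fps_X) * (k\<^sup>2 - 5 * k + fps_X * k + 4)"
    unfolding w by (simp add: algebra_simps power2_eq_square)
  also have "\<dots> = 0" unfolding q by simp
  finally have "k * (3 + (1 - fps_X) * w) = 4 * w" by simp
  moreover have "(1 - fps_X) * k * w * (1 + 3 * Us) = k * ((1 - fps_X) * w + 3 * ((1 - fps_X) * w * Us))"
    by (simp add: algebra_simps)
  moreover have "(1 - fps_X) * k * w * (4 * Ut) = 4 * w * ((1 - fps_X) * k * Ut)"
    by (simp add: algebra_simps)
  ultimately have "(1 - fps_X) * k * w * (1 + 3 * Us) = (1 - fps_X) * k * w * (4 * Ut)"
    unfolding t s by (simp add: algebra_simps)
  then have "1 + 3 * Us = 4 * Ut" using nz by simp
  from arg_cong[OF this, of "\<lambda>f. fps_nth f (Suc n)"] show ?thesis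
    by (simp add: Us_def Ut_def numeral_fps_const)
qed

section \<open>Subharmonicity of the hitting probability\<close>

text \<open>The indicator list of \<open>A \<union> (A + 1)\<close> when \<open>l\<close> is that of \<open>A\<close>; the Boolean says whether the site
  before the list belongs to \<open>A\<close>.\<close>
primrec nbh_list :: "bool \<Rightarrow> bool list \<Rightarrow> bool list" where
  "nbh_list b [] = [b]"
| "nbh_list b (c # l) = (b \<or> c) # nbh_list c l"

definition head_open :: "bool list \<Rightarrow> bool" where
  "head_open l = (case l of [] \<Rightarrow> False | c # _ \<Rightarrow> c)"

definition nbh_tail :: "bool list \<Rightarrow> bool list" where
  "nbh_tail l = (case l of [] \<Rightarrow> [] | c # l' \<Rightarrow> nbh_list c l')"

lemma head_open_Cons [simp]: "head_open (c # l) = c"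
  by (simp add: head_open_def)

lemma nbh_list_eq: "nbh_list c l = (c \<or> head_open l) # nbh_tail l"
  by (cases l) (auto simp: head_open_def nbh_tail_def)

lemma nbh_tail_Cons [simp]: "nbh_tail (c # l) = nbh_list c l"
  by (simp add: nbh_tail_def)

lemma nbh_tail_Nil [simp]: "nbh_tail [] = []"
  by (simp add: nbh_tail_def)

text \<open>The weight of a void past whose last point is at position \<open>k\<close> of the
  reversed past. By reversibility the older past, read backwards from this point, is a renewal
  process with the same gaps.\<close>

definition age_weight :: "bool list \<Rightarrow> nat \<Rightarrow> real" where
  "age_weight r k = (if r ! k then 0 else surv_fun gap_ratio k * renewal_void gap_ratio 0 (drop (Suc k) r))"

lemma age_weight_Cons_0: "age_weight (c # r) 0 = (if c then 0 else renewal_void gap_ratio 0 r)"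
  by (simp add: age_weight_def)

lemma age_weight_Cons_Suc: "age_weight (c # r) (Suc k) = gap_ratio k * age_weight r k"
  by (simp add: age_weight_def)

text \<open>Both sides weigh a void past together with a point on the next site: the left by the
  position of its predecessor, the right by reading backwards from it.\<close>

lemma sum_age_weight:
  "surv_fun gap_ratio (length r) + (\<Sum>k<length r. age_weight r k * (1 - gap_ratio k)) = renewal_void gap_ratio 0 r"
proof -
  have "(\<Sum>k<length r. age_weight r k * (1 - gap_ratio k)) =
    (\<Sum>k<length r. (surv_fun gap_ratio k - surv_fun gap_ratio (Suc k)) *
        (if r ! k then 0 else renewal_void gap_ratio 0 (drop (Suc k) r)))"
    by (intro sum.cong) (auto simp: age_weight_def algebra_simps)
  then show ?thesis using renewal_void_first_point[of gap_ratio 0 r] by simp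
qed

text \<open>The difference of the two sides is the increment of the void probability to the left of
  the cut; its sign comes from \<open>renewal_void_shift\<close>, read backwards.\<close>

lemma age_weight_0_le:
  assumes "r \<noteq> []"
  shows "age_weight r 0 \<le> renewal_void gap_ratio 0 r"
proof -
  obtain c r' where r: "r = c # r'" using assms by (cases r) auto
  show ?thesis
    using renewal_void_shift[of gap_ratio r'] renewal_void_nonneg[of gap_ratio 0 r] gap_ratio_bounds
    by (auto simp: age_weight_Cons_0 r simp del: renewal_void.simps)
qed

text \<open>Void weights with reversed past \<open>r\<close> and future \<open>l\<close>: for the renewal process itself, and for the
  process that follows the thinned dynamics in the future only.\<close>
definition pure_void :: "bool list \<Rightarrow> bool list \<Rightarrow> real" where
  "pure_void r l = stat_void gap_ratio (3 / 2) (length r) l +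
     (\<Sum>k<length r. age_weight r k * renewal_void gap_ratio k l)"

text \<open>One neighbourhood site straddles the cut. With \<open>K = surv_fun thin_ratio\<close>,
  the weight of a point right before the cut splits as 1 = 3/4 (K 0 + K 1): 3/4 for a thinned point
  on the straddling site and 1/4 for one a site earlier. For \<open>k > 0\<close> the tails are
  proportional, and the straddling site makes age \<open>k\<close> into
  \<open>Suc k\<close>.\<close>

definition future_void :: "nat \<Rightarrow> bool list \<Rightarrow> real" where
  "future_void k l =
     (if k = 0 then renewal_void thin_ratio 1 (nbh_tail l) / 4 +
        (if head_open l then 0 else 3 / 4 * renewal_void thin_ratio 0 (nbh_tail l))
      else renewal_void thin_ratio (Suc k) (nbh_tail l))"

definition hybrid_void :: "bool list \<Rightarrow> bool list \<Rightarrow> real" where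
  "hybrid_void r l = 3 / 4 * stat_void thin_ratio 2 (Suc (length r)) (nbh_tail l) +
     (\<Sum>k<length r. age_weight r k * future_void k l)"

text \<open>One process governs both sides, so it does not notice where the cut is.\<close>

lemma pure_void_step: "pure_void r (c # l) = pure_void (c # r) l"
proof -
  let ?v = "renewal_void gap_ratio 0 l"
  have "pure_void r (c # l) = stat_void gap_ratio (3 / 2) (Suc (length r)) l +
      (\<Sum>k<length r. gap_ratio k * age_weight r k * renewal_void gap_ratio (Suc k) l) +
      (if c then 0 else (surv_fun gap_ratio (length r) + (\<Sum>k<length r. age_weight r k * (1 - gap_ratio k))) * ?v)"
    by (auto simp: pure_void_def algebra_simps sum.distrib sum_distrib_left sum_subtractf)
  also have "\<dots> = pure_void (c # r) l"
    unfolding sum_age_weight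
    by (simp add: pure_void_def sum.lessThan_Suc_shift age_weight_Cons_0 age_weight_Cons_Suc
        del: sum.lessThan_Suc)
  finally show ?thesis .
qed

text \<open>\<open>G\<close> is the void probability to the right, given a thinned point on the new
  straddling site. Up to a correction at age 0, moving on by a site behaves like a renewal step with
  the gap law; the correction is the increment of the void probability to the right.\<close>

lemma future_void_step:
  fixes l :: "bool list"
  assumes c: "\<not> c"
  defines "G \<equiv> if head_open l then 0 else renewal_void thin_ratio 0 (nbh_tail l)"
  shows "future_void k (c # l) - gap_ratio k * future_void (Suc k) l =
    (1 - gap_ratio k) * G - (if k = 0 then 3 / 4 * (G - renewal_void thin_ratio 0 (nbh_list False l)) else 0)"
  using c by (auto simp: future_void_def nbh_list_eq G_def gap_ratio_def field_simps simp del: thin_ratio.simps(2)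
      simp flip: One_nat_def)

lemma future_void_0:
  fixes l :: "bool list"
  defines "G \<equiv> if head_open l then 0 else renewal_void thin_ratio 0 (nbh_tail l)"
  shows "future_void 0 l = G - 3 / 4 * (G - renewal_void thin_ratio 0 (nbh_list False l))"
  by (auto simp: future_void_def nbh_list_eq G_def field_simps)

lemma hybrid_void_step:
  assumes r: "r \<noteq> []"
  shows "hybrid_void r (c # l) \<le> hybrid_void (c # r) l"
proof -
  have H: "hybrid_void (c # r) l = 3 / 4 * stat_void thin_ratio 2 (Suc (Suc (length r))) (nbh_tail l) +
     (if c then 0 else renewal_void gap_ratio 0 r * future_void 0 l) +
     (\<Sum>k<length r. age_weight r k * (gap_ratio k * future_void (Suc k) l))"
    by (simp add: hybrid_void_def sum.lessThan_Suc_shift age_weight_Cons_0 age_weight_Cons_Suc algebra_simps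
        del: sum.lessThan_Suc)
  show ?thesis
  proof (cases c)
    case True
    have "future_void k (c # l) = gap_ratio k * future_void (Suc k) l" for k
      using True by (auto simp: future_void_def nbh_list_eq gap_ratio_def simp del: thin_ratio.simps(2) simp flip: One_nat_def)
    then show ?thesis unfolding H using True by (simp add: hybrid_void_def nbh_list_eq)
  next
    case False
    define G where "G = (if head_open l then 0 else renewal_void thin_ratio 0 (nbh_tail l))"
    define D where "D = G - renewal_void thin_ratio 0 (nbh_list False l)"
    have D: "D \<le> 0"
      using renewal_void_shift[of thin_ratio "nbh_tail l"] renewal_void_nonneg[of thin_ratio 0] thin_ratio_bounds
      by (auto simp: D_def G_def nbh_list_eq simp del: renewal_void.simps thin_ratio.simps)
    \<comment> \<open>The tails are proportional only from index 1 on; this is why the past must be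
      nonempty.\<close>
    have "surv_fun gap_ratio (length r) = 3 / 4 * surv_fun thin_ratio (Suc (length r))"
      using r by (cases r) (auto simp: surv_fun_gap_ratio simp del: surv_fun.simps)
    then have s: "3 / 4 * stat_void thin_ratio 2 (Suc (length r)) (nbh_list c l) =
        3 / 4 * stat_void thin_ratio 2 (Suc (Suc (length r))) (nbh_tail l) + surv_fun gap_ratio (length r) * G"
      using False by (simp add: nbh_list_eq G_def algebra_simps del: surv_fun.simps)
    have "hybrid_void r (c # l) - hybrid_void (c # r) l =
        surv_fun gap_ratio (length r) * G - renewal_void gap_ratio 0 r * (G - 3 / 4 * D) +
        (\<Sum>k<length r. age_weight r k * (future_void k (c # l) - gap_ratio k * future_void (Suc k) l))"
      unfolding H hybrid_void_def[of r] nbh_tail_Cons s future_void_0[of l, folded G_def, folded D_def]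
      using False by (simp add: right_diff_distrib sum_subtractf)
    also have "(\<Sum>k<length r. age_weight r k * (future_void k (c # l) - gap_ratio k * future_void (Suc k) l)) =
        (\<Sum>k<length r. age_weight r k * (1 - gap_ratio k) * G - (if k = 0 then age_weight r 0 * (3 / 4 * D) else 0))"
      unfolding future_void_step[OF False, of _ l, folded G_def, folded D_def]
      by (intro sum.cong) (auto simp: algebra_simps)
    also have "\<dots> = (\<Sum>k<length r. age_weight r k * (1 - gap_ratio k)) * G - age_weight r 0 * (3 / 4 * D)"
      using r by (simp add: sum_subtractf sum_distrib_right sum.delta)
    \<comment> \<open>By \<open>sum_age_weight\<close> all multiples of \<open>G\<close> cancel, and
      the product of the two increments is left.\<close>
    also have "surv_fun gap_ratio (length r) * G - renewal_void gap_ratio 0 r * (G - 3 / 4 * D) +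
        ((\<Sum>k<length r. age_weight r k * (1 - gap_ratio k)) * G - age_weight r 0 * (3 / 4 * D)) =
        3 / 4 * (D * (renewal_void gap_ratio 0 r - age_weight r 0))"
      by (simp add: sum_age_weight[symmetric] algebra_simps)
    also have "\<dots> \<le> 0"
      using D age_weight_0_le[OF r] by (simp add: mult_nonpos_nonneg)
    finally show ?thesis by simp
  qed
qed

lemma hybrid_void_le: "r \<noteq> [] \<Longrightarrow> hybrid_void r l \<le> pure_void r l"
proof (induction l arbitrary: r)
  case Nil
  then obtain j where j: "length r = Suc j" by (cases r) auto
  \<comment> \<open>Once the future is exhausted, the weights can differ only in the term for a past
    without points, and the interval identity settles it.\<close>
  have "3 / 4 * (2 - (\<Sum>k<Suc (length r). surv_fun thin_ratio k)) = 3 / 2 - (\<Sum>k<length r. surv_fun gap_ratio k)"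
    using sum_surv_fun_gap_ratio[of j] by (simp add: j del: surv_fun.simps sum.lessThan_Suc)
  moreover have "future_void k [] = 1" for k by (simp add: future_void_def head_open_def)
  ultimately show ?case
    by (simp add: hybrid_void_def pure_void_def del: surv_fun.simps sum.lessThan_Suc)
next
  case (Cons c l)
  then show ?case
    using order.trans[OF hybrid_void_step[OF Cons.prems, of c l] Cons.IH[of "c # r"]]
    unfolding pure_void_step by blast
qed

lemma stat_void_nbh_list: "3 / 4 * stat_void thin_ratio 2 0 (nbh_list False l) \<le> stat_void gap_ratio (3 / 2) 0 l"
proof (cases l)
  case (Cons c l')
  \<comment> \<open>The first site is put into the past at once, since the comparison starts from a
    nonempty past.\<close>
  have "3 / 4 * stat_void thin_ratio 2 0 (nbh_list False l) = hybrid_void [c] l'"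
    by (auto simp: Cons hybrid_void_def nbh_list_eq future_void_def age_weight_def)
  also have "\<dots> \<le> pure_void [c] l'" by (intro hybrid_void_le) simp
  also have "\<dots> = stat_void gap_ratio (3 / 2) 0 l"
    unfolding pure_void_step[symmetric] Cons by (simp add: pure_void_def)
  finally show ?thesis .
qed simp

lemma stat_thinned_void_le:
  "stat_thinned_void gap_ratio (3 / 2) (1 / 4) 0 (nbh_list False l) \<le> stat_void gap_ratio (3 / 2) 0 l"
  using stat_void_nbh_list[of l] stat_thinned_void_eq[of thin_ratio "1 / 4" gap_ratio "3 / 2" 2 "nbh_list False l"]
    renewal_prob_thin_ratio by simp

section \<open>Expectations over finitely many sites\<close>

definition site_exp :: "real \<Rightarrow> 'v set \<Rightarrow> ('v set \<Rightarrow> real) \<Rightarrow> real" where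
  "site_exp p S F = (\<Sum>T\<in>Pow S. p ^ card T * (1 - p) ^ card (S - T) * F T)"

lemma site_exp_empty [simp]: "site_exp p {} F = F {}"
  by (simp add: site_exp_def)

lemma site_exp_cong:
  assumes "\<And>T. T \<subseteq> S \<Longrightarrow> F T = G T"
  shows "site_exp p S F = site_exp p S G"
  unfolding site_exp_def by (intro sum.cong) (auto simp: assms)

lemma site_exp_insert:
  assumes "finite S" "x \<notin> S"
  shows "site_exp p (insert x S) F = p * site_exp p S (\<lambda>T. F (insert x T)) + (1 - p) * site_exp p S F"
proof -
  have inj: "inj_on (insert x) (Pow S)"
    using assms(2) by (auto simp: inj_on_def)
  have "site_exp p (insert x S) F =
      (\<Sum>T\<in>Pow S. p ^ card T * (1 - p) ^ card (insert x S - T) * F T) +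
      (\<Sum>T\<in>insert x ` Pow S. p ^ card T * (1 - p) ^ card (insert x S - T) * F T)"
    unfolding site_exp_def Pow_insert using assms by (intro sum.union_disjoint) auto
  also have "(\<Sum>T\<in>insert x ` Pow S. p ^ card T * (1 - p) ^ card (insert x S - T) * F T) =
      p * site_exp p S (\<lambda>T. F (insert x T))"
    unfolding sum.reindex[OF inj] site_exp_def sum_distrib_left
  proof (intro sum.cong refl)
    fix T assume T: "T \<in> Pow S"
    then have "finite T" "x \<notin> T" using assms finite_subset by auto
    moreover have "insert x S - insert x T = S - T" using assms by auto
    ultimately show "((\<lambda>T. p ^ card T * (1 - p) ^ card (insert x S - T) * F T) \<circ> insert x) T =
        p * (p ^ card T * (1 - p) ^ card (S - T) * F (insert x T))" by simp
  qed
  also have "(\<Sum>T\<in>Pow S. p ^ card T * (1 - p) ^ card (insert x S - T) * F T) = (1 - p) * site_exp p S F"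
    unfolding site_exp_def sum_distrib_left
  proof (intro sum.cong refl)
    fix T assume T: "T \<in> Pow S"
    then have "insert x S - T = insert x (S - T)" using assms by auto
    then show "p ^ card T * (1 - p) ^ card (insert x S - T) * F T =
        (1 - p) * (p ^ card T * (1 - p) ^ card (S - T) * F T)" using assms by simp
  qed
  finally show ?thesis by simp
qed

lemma site_exp_add: "site_exp p S (\<lambda>T. F T + G T) = site_exp p S F + site_exp p S G"
  by (simp add: site_exp_def distrib_left sum.distrib)

lemma site_exp_cmult: "site_exp p S (\<lambda>T. c * F T) = c * site_exp p S F"
  by (simp add: site_exp_def sum_distrib_left mult_ac)

lemma site_exp_sum: "site_exp p S (\<lambda>T. \<Sum>i\<in>I. F i T) = (\<Sum>i\<in>I. site_exp p S (F i))"
  unfolding site_exp_def sum_distrib_left by (rule sum.swap)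

lemma site_exp_const: "finite S \<Longrightarrow> site_exp p S (\<lambda>_. c) = c"
  by (induction S rule: finite_induct) (auto simp: site_exp_insert algebra_simps)

lemma site_exp_mono:
  assumes "0 \<le> p" "p \<le> 1" "\<And>T. T \<subseteq> S \<Longrightarrow> F T \<le> G T"
  shows "site_exp p S F \<le> site_exp p S G"
  unfolding site_exp_def using assms by (intro sum_mono mult_left_mono) auto

lemma site_exp_bounds:
  assumes "0 \<le> p" "p \<le> 1" "finite S" "\<And>T. T \<subseteq> S \<Longrightarrow> a \<le> F T \<and> F T \<le> b"
  shows "a \<le> site_exp p S F \<and> site_exp p S F \<le> b"
  using site_exp_mono[of p S "\<lambda>_. a" F] site_exp_mono[of p S F "\<lambda>_. b"] assms by (simp add: site_exp_const)

lemma site_exp_union: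
  assumes "finite S" "finite R" "S \<inter> R = {}"
  shows "site_exp p (S \<union> R) F = site_exp p S (\<lambda>T. site_exp p R (\<lambda>U. F (T \<union> U)))"
  using assms(1,3)
proof (induction S arbitrary: F rule: finite_induct)
  case (insert x S)
  then have "site_exp p (insert x S \<union> R) F =
     p * site_exp p (S \<union> R) (\<lambda>T. F (insert x T)) + (1 - p) * site_exp p (S \<union> R) F"
    using site_exp_insert[of "S \<union> R" x p F] assms(2) by auto
  also have "\<dots> = site_exp p (insert x S) (\<lambda>T. site_exp p R (\<lambda>U. F (T \<union> U)))"
    using insert by (simp add: site_exp_insert)
  finally show ?case .
qed simp

lemma site_exp_depends:
  assumes "finite S" "\<And>T. F T = F (T \<inter> D)"
  shows "site_exp p S F = site_exp p (S \<inter> D) F"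
proof -
  have "site_exp p (S \<inter> D \<union> (S - D)) F = site_exp p (S \<inter> D) (\<lambda>T. site_exp p (S - D) (\<lambda>U. F (T \<union> U)))"
    using assms by (intro site_exp_union) auto
  also have "\<dots> = site_exp p (S \<inter> D) (\<lambda>T. site_exp p (S - D) (\<lambda>U. F T))"
  proof (intro site_exp_cong)
    fix T U assume "T \<subseteq> S \<inter> D" "U \<subseteq> S - D"
    then have "(T \<union> U) \<inter> D = T \<inter> D" by auto
    then show "F (T \<union> U) = F T" using assms(2) by metis
  qed
  also have "\<dots> = site_exp p (S \<inter> D) F" using assms by (simp add: site_exp_const)
  also have "S \<inter> D \<union> (S - D) = S" by auto
  finally show ?thesis .
qed

text \<open>Disjoint parts of a configuration are independent, so one of them may be read off an
  independent copy; this is what lets an exploration continue with a new configuration.\<close>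

lemma site_exp_indep:
  assumes S: "finite S" and dep: "\<And>T U. F T U = F (T \<inter> D) (U \<inter> E)" and disj: "D \<inter> E = {}"
  shows "site_exp p S (\<lambda>T. F T T) = site_exp p S (\<lambda>T. site_exp p S (F T))"
proof -
  have [simp]: "S \<inter> D \<union> (S - D) = S" by auto
  have fin: "finite (S \<inter> D)" "finite (S - D)" using S by auto
  have "site_exp p (S \<inter> D \<union> (S - D)) (\<lambda>T. F T T) =
      site_exp p (S \<inter> D) (\<lambda>T. site_exp p (S - D) (\<lambda>U. F (T \<union> U) (T \<union> U)))"
    using fin by (intro site_exp_union) auto
  also have "\<dots> = site_exp p (S \<inter> D) (\<lambda>T. site_exp p (S - D) (F T))"
  proof (intro site_exp_cong)
    fix T U assume "T \<subseteq> S \<inter> D" "U \<subseteq> S - D"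
    then have "(T \<union> U) \<inter> D = T \<inter> D" "(T \<union> U) \<inter> E = U \<inter> E" using disj by auto
    then show "F (T \<union> U) (T \<union> U) = F T U" using dep by metis
  qed
  also have "\<dots> = site_exp p (S \<inter> D) (\<lambda>T. site_exp p S (F T))"
  proof (intro site_exp_cong)
    fix T
    have 1: "F T U = F T (U \<inter> E)" for U using dep[of T U] dep[of T "U \<inter> E"] by (simp add: Int_assoc)
    have "site_exp p (S - D) (F T) = site_exp p ((S - D) \<inter> E) (F T)"
      using fin 1 by (intro site_exp_depends) auto
    also have "(S - D) \<inter> E = S \<inter> E" using disj by auto
    also have "site_exp p (S \<inter> E) (F T) = site_exp p S (F T)"
      using S 1 by (intro site_exp_depends[symmetric]) auto
    finally show "site_exp p (S - D) (F T) = site_exp p S (F T)" .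
  qed
  also have "\<dots> = site_exp p S (\<lambda>T. site_exp p S (F T))"
  proof (intro site_exp_depends[symmetric] S)
    fix T
    have "F T = F (T \<inter> D)"
    proof
      fix U show "F T U = F (T \<inter> D) U" using dep[of T U] dep[of "T \<inter> D" U] by (simp add: Int_assoc)
    qed
    then show "site_exp p S (F T) = site_exp p S (F (T \<inter> D))" by simp
  qed
  finally show ?thesis by simp
qed

lemma site_exp_image:
  assumes "finite S" "inj_on f S"
  shows "site_exp p (f ` S) F = site_exp p S (\<lambda>T. F (f ` T))"
  using assms
proof (induction S arbitrary: F rule: finite_induct)
  case (insert x S)
  then have "f x \<notin> f ` S" by auto
  then show ?case using insert by (simp add: site_exp_insert)
qed simp

lemma site_exp_card: "finite S \<Longrightarrow> site_exp p S (\<lambda>T. real (card T)) = p * card S"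
proof (induction S rule: finite_induct)
  case (insert x S)
  have "site_exp p S (\<lambda>T. real (card (insert x T))) = site_exp p S (\<lambda>T. 1 + real (card T))"
  proof (intro site_exp_cong)
    fix T assume "T \<subseteq> S"
    then have "finite T" "x \<notin> T" using insert finite_subset by auto
    then show "real (card (insert x T)) = 1 + real (card T)" by simp
  qed
  then show ?case using insert
    by (simp add: site_exp_insert site_exp_add site_exp_const algebra_simps)
qed simp

lemma site_exp_Un_thin:
  assumes "finite S"
  shows "site_exp a S (\<lambda>U. site_exp b S (\<lambda>V. g (U \<union> V))) = site_exp (1 - (1 - a) * (1 - b)) S g"
  using assms
proof (induction S arbitrary: g rule: finite_induct)
  case (insert x S)
  then show ?case
    by (simp add: site_exp_insert site_exp_add site_exp_cmult insert.IH[of g]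
        insert.IH[of "\<lambda>T. g (insert x T)"]) (simp add: algebra_simps)
qed simp

lemma site_exp_Int_thin:
  assumes "finite S"
  shows "site_exp a S (\<lambda>U. site_exp b S (\<lambda>V. g (U \<inter> V))) = site_exp (a * b) S g"
  using assms
proof (induction S arbitrary: g rule: finite_induct)
  case (insert x S)
  have 1: "site_exp b S (\<lambda>V. g (insert x U \<inter> V)) = site_exp b S (\<lambda>V. g (U \<inter> V))" for U
    using insert by (intro site_exp_cong arg_cong[of _ _ g]) auto
  have 2: "site_exp a S (\<lambda>U. site_exp b S (\<lambda>V. g (U \<inter> insert x V))) =
      site_exp a S (\<lambda>U. site_exp b S (\<lambda>V. g (U \<inter> V)))"
    using insert by (intro site_exp_cong arg_cong[of _ _ g]) auto
  have "insert x U \<inter> insert x V = insert x (U \<inter> V)" for U V by auto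
  then show ?case
    using insert by (simp add: site_exp_insert site_exp_add site_exp_cmult 1 2 insert.IH[of g]
        insert.IH[of "\<lambda>T. g (insert x T)"]) (simp add: algebra_simps)
qed simp

text \<open>Over an infinite set \<open>site_exp\<close> is a sum with infinitely many indices,
  hence 0 by convention; monotonicity is therefore demanded on finite sets only.\<close>

definition finite_mono :: "('v set \<Rightarrow> real) \<Rightarrow> bool" where
  "finite_mono g \<longleftrightarrow> (\<forall>A B. A \<subseteq> B \<longrightarrow> finite B \<longrightarrow> g A \<le> g B)"

lemma finite_monoD: "finite_mono g \<Longrightarrow> A \<subseteq> B \<Longrightarrow> finite B \<Longrightarrow> g A \<le> g B"
  by (auto simp: finite_mono_def)

lemma site_exp_mono_set:
  assumes "0 \<le> p" "p \<le> 1" "finite_mono g" "S \<subseteq> R" "finite R"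
  shows "site_exp p S g \<le> site_exp p R g"
proof -
  have R: "S \<union> (R - S) = R" and fin: "finite S" using assms finite_subset by auto
  have "site_exp p S g = site_exp p S (\<lambda>T. site_exp p (R - S) (\<lambda>_. g T))"
    using assms by (simp add: site_exp_const)
  also have "\<dots> \<le> site_exp p S (\<lambda>T. site_exp p (R - S) (\<lambda>U. g (T \<union> U)))"
    using assms fin by (intro site_exp_mono finite_monoD[OF assms(3)]) (auto dest: finite_subset)
  also have "\<dots> = site_exp p (S \<union> (R - S)) g"
    using assms fin by (intro site_exp_union[symmetric]) auto
  finally show ?thesis unfolding R .
qed

lemma site_exp_mono_prob:
  assumes "0 \<le> a" "a \<le> b" "b \<le> 1" "finite_mono g" "finite S"
  shows "site_exp a S g \<le> site_exp b S g"
  using assms(5,4)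
proof (induction S arbitrary: g rule: finite_induct)
  case (insert x S)
  have g': "finite_mono (\<lambda>T. g (insert x T))"
    unfolding finite_mono_def using insert.prems by (auto intro!: finite_monoD)
  have "site_exp a S g \<le> site_exp a S (\<lambda>T. g (insert x T))"
    using assms insert by (intro site_exp_mono finite_monoD[OF insert.prems]) (auto dest: finite_subset)
  then have "a * site_exp a S (\<lambda>T. g (insert x T)) + (1 - a) * site_exp a S g \<le>
    b * site_exp a S (\<lambda>T. g (insert x T)) + (1 - b) * site_exp a S g"
    using mult_right_mono[of a b "site_exp a S (\<lambda>T. g (insert x T)) - site_exp a S g"] assms
    by (simp add: algebra_simps)
  also have "\<dots> \<le> b * site_exp b S (\<lambda>T. g (insert x T)) + (1 - b) * site_exp b S g"
    using assms insert.IH[OF g'] insert.IH[OF insert.prems] by (intro add_mono mult_left_mono) auto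
  finally show ?case using insert by (simp add: site_exp_insert)
qed simp

section \<open>Survival probabilities of set-valued Markov chains\<close>

primrec survival :: "('v set \<Rightarrow> 'v set) \<Rightarrow> real \<Rightarrow> nat \<Rightarrow> 'v set \<Rightarrow> real" where
  "survival N a 0 A = (if A = {} then 0 else 1)"
| "survival N a (Suc m) A = site_exp a (N A) (survival N a m)"

definition growth_map :: "('v set \<Rightarrow> 'v set) \<Rightarrow> bool" where
  "growth_map N \<longleftrightarrow> mono N \<and> (\<forall>A. finite A \<longrightarrow> finite (N A))"

lemma growth_mapD: "growth_map N \<Longrightarrow> A \<subseteq> B \<Longrightarrow> N A \<subseteq> N B" "growth_map N \<Longrightarrow> finite A \<Longrightarrow> finite (N A)"
  by (auto simp: growth_map_def mono_def)

lemma finite_mono_survival: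
  assumes "growth_map N" "0 \<le> a" "a \<le> 1"
  shows "finite_mono (survival N a m)"
proof (induction m)
  case (Suc m)
  then show ?case
    unfolding finite_mono_def
    using site_exp_mono_set[OF assms(2,3) Suc] growth_mapD[OF assms(1)] by auto
qed (auto simp: finite_mono_def)

lemma survival_bounds:
  assumes "growth_map N" "0 \<le> a" "a \<le> 1" "finite A"
  shows "0 \<le> survival N a m A \<and> survival N a m A \<le> 1"
  using assms(4)
proof (induction m arbitrary: A)
  case (Suc m)
  have "finite (N A)" using Suc growth_mapD[OF assms(1)] by auto
  then show ?case using assms Suc.IH finite_subset
    by (simp, intro site_exp_bounds) auto
qed auto

lemma survival_mono_prob:
  assumes "growth_map N" "0 \<le> a" "a \<le> b" "b \<le> 1" "finite A"
  shows "survival N a m A \<le> survival N b m A"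
  using assms(5)
proof (induction m arbitrary: A)
  case (Suc m)
  have fin: "finite (N A)" using Suc growth_mapD[OF assms(1)] by auto
  have "site_exp a (N A) (survival N a m) \<le> site_exp a (N A) (survival N b m)"
    using assms Suc fin finite_subset by (intro site_exp_mono) auto
  also have "\<dots> \<le> site_exp b (N A) (survival N b m)"
    using assms fin by (intro site_exp_mono_prob finite_mono_survival) auto
  finally show ?case by simp
qed auto

section \<open>The planar process and the stationary renewal set\<close>

definition nat_nbh :: "nat set \<Rightarrow> nat set" where
  "nat_nbh A = A \<union> Suc ` A"

lemma growth_map_nat_nbh: "growth_map nat_nbh"
  by (auto simp: growth_map_def nat_nbh_def mono_def)

definition indicator_list :: "nat \<Rightarrow> nat set \<Rightarrow> bool list" where
  "indicator_list L A = map (\<lambda>i. i \<in> A) [0..<L]"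

lemma length_nbh_list [simp]: "length (nbh_list b l) = Suc (length l)"
  by (induction l arbitrary: b) auto

lemma nth_nbh_list:
  "i \<le> length l \<Longrightarrow> nbh_list b l ! i \<longleftrightarrow>
    (if i = 0 then b else l ! (i - 1)) \<or> (i < length l \<and> l ! i)"
  by (induction l arbitrary: b i) (auto simp: nth_Cons split: nat.splits)

lemma nbh_list_indicator:
  assumes "A \<subseteq> {..<L}"
  shows "nbh_list False (indicator_list L A) = indicator_list (Suc L) (nat_nbh A)"
proof (rule nth_equalityI)
  fix i assume "i < length (nbh_list False (indicator_list L A))"
  then have i: "i \<le> L" by (simp add: indicator_list_def)
  then have r: "indicator_list (Suc L) (nat_nbh A) ! i \<longleftrightarrow> i \<in> nat_nbh A"
    unfolding indicator_list_def by (subst nth_map) (auto simp del: upt_Suc)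
  have len: "length (indicator_list L A) = L" by (simp add: indicator_list_def)
  have l: "indicator_list L A ! j \<longleftrightarrow> j \<in> A" if "j < L" for j
    using that by (simp add: indicator_list_def)
  have "nbh_list False (indicator_list L A) ! i \<longleftrightarrow> (i \<noteq> 0 \<and> i - 1 \<in> A) \<or> (i < L \<and> i \<in> A)"
    using nth_nbh_list[of i "indicator_list L A" False, unfolded len, OF i] i l by auto
  also have "\<dots> \<longleftrightarrow> i \<in> nat_nbh A"
    using assms by (cases i) (auto simp: nat_nbh_def)
  finally show "nbh_list False (indicator_list L A) ! i = indicator_list (Suc L) (nat_nbh A) ! i"
    using r by simp
qed (simp add: indicator_list_def)

lemma site_exp_if:
  assumes "finite S" "\<And>T. G (insert x T) = G T"
  shows "site_exp p S (\<lambda>T. if x \<in> T then 0 else G T) = (if x \<in> S then 1 - p else 1) * site_exp p S G"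
proof (cases "x \<in> S")
  case True
  then obtain R where R: "S = insert x R" "x \<notin> R" by (meson mk_disjoint_insert)
  have "site_exp p R (\<lambda>T. if x \<in> T then 0 else G T) = site_exp p R G"
    using R by (intro site_exp_cong) auto
  then show ?thesis
    using R assms by (simp add: site_exp_insert assms(2) site_exp_const algebra_simps)
next
  case False
  then show ?thesis by (auto intro!: site_exp_cong)
qed

text \<open>A meeting fails in the same way whether the marked site or the point on it is deleted,
  so thinning the marked set amounts to thinning the renewal points.\<close>

lemma site_exp_renewal_void:
  assumes "finite S"
  shows "site_exp p S (\<lambda>T. renewal_void t k (map (\<lambda>i. i \<in> T) [x..<x + n])) =
    thinned_void t (1 - p) k (map (\<lambda>i. i \<in> S) [x..<x + n])"
proof (induction n arbitrary: k x)
  case (Suc n)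
  have u: "[x..<x + Suc n] = x # [Suc x..<Suc x + n]" by (simp add: upt_conv_Cons)
  define G where "G T = (1 - t k) * renewal_void t 0 (map (\<lambda>i. i \<in> T) [Suc x..<Suc x + n])" for T
  have G: "G (insert x T) = G T" for T
    unfolding G_def by (intro arg_cong[of _ _ "\<lambda>l. _ * renewal_void t 0 l"]) auto
  have "site_exp p S (\<lambda>T. renewal_void t k (map (\<lambda>i. i \<in> T) [x..<x + Suc n])) =
     site_exp p S (\<lambda>T. t k * renewal_void t (Suc k) (map (\<lambda>i. i \<in> T) [Suc x..<Suc x + n]) + (if x \<in> T then 0 else G T))"
    unfolding u by (simp add: G_def del: upt_Suc cong: if_cong)
  also have "\<dots> = t k * thinned_void t (1 - p) (Suc k) (map (\<lambda>i. i \<in> S) [Suc x..<Suc x + n]) +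
     (if x \<in> S then 1 - p else 1) * site_exp p S G"
    using site_exp_if[of S G x p] assms G by (simp only: site_exp_add site_exp_cmult Suc)
  also have "site_exp p S G = (1 - t k) * thinned_void t (1 - p) 0 (map (\<lambda>i. i \<in> S) [Suc x..<Suc x + n])"
    unfolding G_def by (simp only: site_exp_cmult Suc)
  finally show ?case unfolding u by (simp del: upt_Suc)
qed (simp add: assms site_exp_const)

lemma site_exp_stat_void:
  assumes "finite S"
  shows "site_exp p S (\<lambda>T. stat_void t \<theta> j (map (\<lambda>i. i \<in> T) [x..<x + n])) =
    stat_thinned_void t \<theta> (1 - p) j (map (\<lambda>i. i \<in> S) [x..<x + n])"
proof (induction n arbitrary: j x)
  case (Suc n)
  have u: "[x..<x + Suc n] = x # [Suc x..<Suc x + n]" by (simp add: upt_conv_Cons)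
  define G where "G T = surv_fun t j * renewal_void t 0 (map (\<lambda>i. i \<in> T) [Suc x..<Suc x + n])" for T
  have G: "G (insert x T) = G T" for T
    unfolding G_def by (intro arg_cong[of _ _ "\<lambda>l. _ * renewal_void t 0 l"]) auto
  have "site_exp p S (\<lambda>T. stat_void t \<theta> j (map (\<lambda>i. i \<in> T) [x..<x + Suc n])) =
     site_exp p S (\<lambda>T. stat_void t \<theta> (Suc j) (map (\<lambda>i. i \<in> T) [Suc x..<Suc x + n]) + (if x \<in> T then 0 else G T))"
    unfolding u by (simp add: G_def del: upt_Suc cong: if_cong)
  also have "\<dots> = stat_thinned_void t \<theta> (1 - p) (Suc j) (map (\<lambda>i. i \<in> S) [Suc x..<Suc x + n]) +
     (if x \<in> S then 1 - p else 1) * site_exp p S G"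
    using site_exp_if[of S G x p] assms G by (simp only: site_exp_add site_exp_cmult Suc)
  also have "site_exp p S G = surv_fun t j * thinned_void t (1 - p) 0 (map (\<lambda>i. i \<in> S) [Suc x..<Suc x + n])"
    unfolding G_def by (simp only: site_exp_cmult site_exp_renewal_void[OF assms])
  finally show ?case unfolding u by (simp del: upt_Suc)
qed (simp add: assms site_exp_const)

lemma stat_void_nonneg: "0 \<le> stat_void gap_ratio (3 / 2) j l"
proof (induction l arbitrary: j)
  case Nil
  then show ?case using sum_surv_fun_gap_ratio_le[of j] by simp
next
  case (Cons b l)
  have "0 \<le> surv_fun gap_ratio n" for n
    by (induction n) (auto simp: gap_ratio_bounds)
  then show ?case
    using Cons[of "Suc j"] renewal_void_nonneg[of gap_ratio 0 l] gap_ratio_bounds by auto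
qed

lemma stat_void_empty: "stat_void t \<theta> 0 (indicator_list L {}) = \<theta>"
  unfolding stat_void_last_point by (simp add: indicator_list_def)

text \<open>The hitting weight \<open>3/2 - stat_void\<close> of the stationary renewal set is a bounded subharmonic function
  of the process, hence it bounds the survival probability.\<close>
lemma survival_nat_nbh_ge:
  assumes "A \<subseteq> {..<L}"
  shows "1 - 2 / 3 * stat_void gap_ratio (3 / 2) 0 (indicator_list L A) \<le> survival nat_nbh (3 / 4) m A"
  using assms
proof (induction m arbitrary: A L)
  case 0
  then show ?case using stat_void_nonneg[of 0 "indicator_list L A"] by (simp add: stat_void_empty)
next
  case (Suc m)
  have "finite A" using Suc.prems finite_subset by blast
  then have fin: "finite (nat_nbh A)" using growth_mapD[OF growth_map_nat_nbh] by auto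
  have sub: "nat_nbh A \<subseteq> {..<Suc L}" using Suc.prems by (auto simp: nat_nbh_def)
  have "1 - 2 / 3 * stat_void gap_ratio (3 / 2) 0 (indicator_list L A) \<le>
      1 - 2 / 3 * stat_thinned_void gap_ratio (3 / 2) (1 / 4) 0 (indicator_list (Suc L) (nat_nbh A))"
    using stat_thinned_void_le[of "indicator_list L A"] Suc.prems by (simp add: nbh_list_indicator)
  also have "\<dots> = site_exp (3 / 4) (nat_nbh A)
      (\<lambda>T. 1 + (- 2 / 3) * stat_void gap_ratio (3 / 2) 0 (indicator_list (Suc L) T))"
    using site_exp_stat_void[OF fin, of "3 / 4" gap_ratio "3 / 2" 0 0 "Suc L"] fin
    unfolding site_exp_add site_exp_cmult by (simp add: indicator_list_def site_exp_const del: upt_Suc)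
  also have "\<dots> \<le> site_exp (3 / 4) (nat_nbh A) (survival nat_nbh (3 / 4) m)"
    using Suc.IH[of _ "Suc L"] sub by (intro site_exp_mono) auto
  finally show ?case by simp
qed

text \<open>The constant is the density of the renewal set, the reciprocal of its mean gap
  3/2.\<close>

lemma survival_nat_nbh_singleton:
  assumes "3 / 4 \<le> a" "a \<le> 1"
  shows "2 / 3 \<le> survival nat_nbh a m {0}"
proof -
  have "2 / 3 \<le> survival nat_nbh (3 / 4) m {0}"
    using survival_nat_nbh_ge[of "{0}" 1 m] by (simp add: indicator_list_def)
  also have "\<dots> \<le> survival nat_nbh a m {0}"
    using assms by (intro survival_mono_prob growth_map_nat_nbh) auto
  finally show ?thesis .
qed

section \<open>Explorations of the open set\<close>

lemma site_exp_minus: "site_exp p S (\<lambda>T. - F T) = - site_exp p S F"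
  using site_exp_cmult[of p S "-1" F] by simp

text \<open>A sequential exploration of the open set \<open>T\<close>. The crucial requirement is \<open>step_determined\<close>: the new
  state may depend on the states of queried sites only through those that are not fresh any more.\<close>
locale exploration =
  fixes step :: "'x \<Rightarrow> 'v set \<Rightarrow> 'x" and fresh query :: "'x \<Rightarrow> 'v set" and inv :: "'x \<Rightarrow> bool"
  assumes finite_query: "inv \<sigma> \<Longrightarrow> finite (query \<sigma>)"
    and step_query: "inv \<sigma> \<Longrightarrow> step \<sigma> (T \<inter> query \<sigma>) = step \<sigma> T"
    and inv_step: "inv \<sigma> \<Longrightarrow> inv (step \<sigma> T)"
    and query_fresh: "inv \<sigma> \<Longrightarrow> query \<sigma> \<subseteq> fresh \<sigma>"
    and fresh_step: "inv \<sigma> \<Longrightarrow> fresh (step \<sigma> T) \<subseteq> fresh \<sigma>"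
    and step_determined: "inv \<sigma> \<Longrightarrow>
      T \<inter> (query \<sigma> - fresh (step \<sigma> T)) = U \<inter> (query \<sigma> - fresh (step \<sigma> T)) \<Longrightarrow> step \<sigma> U = step \<sigma> T"
begin

primrec run :: "nat \<Rightarrow> 'x \<Rightarrow> 'v set \<Rightarrow> 'x" where
  "run 0 \<sigma> T = \<sigma>"
| "run (Suc m) \<sigma> T = run m (step \<sigma> T) T"

lemma run_Suc_end: "run (Suc m) \<sigma> T = step (run m \<sigma> T) T"
  by (induction m arbitrary: \<sigma>) auto

lemma inv_run: "inv \<sigma> \<Longrightarrow> inv (run m \<sigma> T)"
  by (induction m arbitrary: \<sigma>) (auto intro: inv_step)

lemma run_fresh: "inv \<sigma> \<Longrightarrow> run m \<sigma> (T \<inter> fresh \<sigma>) = run m \<sigma> T"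
proof (induction m arbitrary: \<sigma> T)
  case (Suc m)
  have "T \<inter> fresh \<sigma> \<inter> query \<sigma> = T \<inter> query \<sigma>" using query_fresh[OF Suc.prems] by auto
  then have s: "step \<sigma> (T \<inter> fresh \<sigma>) = step \<sigma> T"
    using step_query[OF Suc.prems] by metis
  have "T \<inter> fresh \<sigma> \<inter> fresh (step \<sigma> T) = T \<inter> fresh (step \<sigma> T)"
    using fresh_step[OF Suc.prems] by auto
  then show ?case
    using s Suc.IH[OF inv_step[OF Suc.prems], of T] Suc.IH[OF inv_step[OF Suc.prems], of _ "T \<inter> fresh \<sigma>"]
    by (metis run.simps(2))
qed simp

lemma step_image_finite: "inv \<sigma> \<Longrightarrow> finite (range (step \<sigma>))"
proof -
  assume \<sigma>: "inv \<sigma>"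
  have "range (step \<sigma>) \<subseteq> step \<sigma> ` Pow (query \<sigma>)"
    using step_query[OF \<sigma>] by (metis (no_types, lifting) Int_lower2 PowI imageI image_subsetI)
  then show ?thesis using finite_query[OF \<sigma>] finite_subset by blast
qed

lemma run_depends_finite:
  assumes "inv \<sigma>"
  shows "\<exists>R. finite R \<and> R \<subseteq> fresh \<sigma> \<and> (\<forall>T. run m \<sigma> (T \<inter> R) = run m \<sigma> T)"
  using assms
proof (induction m arbitrary: \<sigma>)
  case (Suc m)
  have "\<forall>\<xi>\<in>range (step \<sigma>). \<exists>R. finite R \<and> R \<subseteq> fresh \<xi> \<and> (\<forall>T. run m \<xi> (T \<inter> R) = run m \<xi> T)"
    using Suc inv_step by auto
  then obtain R where R: "\<And>\<xi>. \<xi> \<in> range (step \<sigma>) \<Longrightarrow> finite (R \<xi>) \<and> R \<xi> \<subseteq> fresh \<xi> \<and>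
      (\<forall>T. run m \<xi> (T \<inter> R \<xi>) = run m \<xi> T)"
    by metis
  define R' where "R' = query \<sigma> \<union> (\<Union>\<xi>\<in>range (step \<sigma>). R \<xi>)"
  have fin: "finite R'"
    unfolding R'_def
    using finite_query[OF Suc.prems] R by (intro finite_UnI finite_UN_I step_image_finite Suc.prems) auto
  have sub: "R' \<subseteq> fresh \<sigma>"
    unfolding R'_def using query_fresh[OF Suc.prems] fresh_step[OF Suc.prems] R by blast
  have "run (Suc m) \<sigma> (T \<inter> R') = run (Suc m) \<sigma> T" for T
  proof -
    have "T \<inter> R' \<inter> query \<sigma> = T \<inter> query \<sigma>" by (auto simp: R'_def)
    then have s: "step \<sigma> (T \<inter> R') = step \<sigma> T" using step_query[OF Suc.prems] by metis
    have "T \<inter> R' \<inter> R (step \<sigma> T) = T \<inter> R (step \<sigma> T)" by (auto simp: R'_def)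
    then show ?thesis using s R[of "step \<sigma> T"] by (metis rangeI run.simps(2))
  qed
  then show ?case using fin sub by blast
qed auto

text \<open>The event that the new state is \<open>\<xi>\<close> is decided outside the fresh sites
  of \<open>\<xi>\<close>, by \<open>step_determined\<close>, whereas the remaining run reads fresh
  sites only; so it may use an independent copy.\<close>

lemma site_exp_run_Suc:
  assumes \<sigma>: "inv \<sigma>" and S: "finite S"
  shows "site_exp p S (\<lambda>T. F (run (Suc m) \<sigma> T)) =
    site_exp p S (\<lambda>T. site_exp p S (\<lambda>U. F (run m (step \<sigma> T) U)))"
proof -
  define X where "X = range (step \<sigma>)"
  have X: "finite X" unfolding X_def by (rule step_image_finite[OF \<sigma>])
  \<comment> \<open>Splitting by the finitely many possible new states makes the set of unread sites
    deterministic.\<close>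
  define H where "H \<xi> T U = (if step \<sigma> T = \<xi> then 1 else 0) * F (run m \<xi> U)" for \<xi> T U
  have H: "(\<Sum>\<xi>\<in>X. H \<xi> T U) = F (run m (step \<sigma> T) U)" for T U
  proof -
    have "(\<Sum>\<xi>\<in>X. H \<xi> T U) = (\<Sum>\<xi>\<in>X. if step \<sigma> T = \<xi> then F (run m \<xi> U) else 0)"
      by (intro sum.cong) (auto simp: H_def)
    also have "\<dots> = F (run m (step \<sigma> T) U)" using X by (simp add: X_def)
    finally show ?thesis .
  qed
  have "site_exp p S (\<lambda>T. H \<xi> T T) = site_exp p S (\<lambda>T. site_exp p S (H \<xi> T))" if "\<xi> \<in> X" for \<xi>
  proof (rule site_exp_indep[OF S])
    fix T U
    have inv: "inv \<xi>" using that inv_step[OF \<sigma>] by (auto simp: X_def)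
    define T' where "T' = T \<inter> (query \<sigma> - fresh \<xi>)"
    have T': "T \<inter> (query \<sigma> - fresh \<xi>) = T' \<inter> (query \<sigma> - fresh \<xi>)" by (auto simp: T'_def)
    have "step \<sigma> T = \<xi> \<longleftrightarrow> step \<sigma> T' = \<xi>"
      using step_determined[OF \<sigma>, of T T'] step_determined[OF \<sigma>, of T' T] T' by metis
    then show "H \<xi> T U = H \<xi> (T \<inter> (query \<sigma> - fresh \<xi>)) (U \<inter> fresh \<xi>)"
      unfolding T'_def[symmetric] by (simp add: H_def run_fresh[OF inv])
  qed auto
  then have "(\<Sum>\<xi>\<in>X. site_exp p S (\<lambda>T. H \<xi> T T)) = (\<Sum>\<xi>\<in>X. site_exp p S (\<lambda>T. site_exp p S (H \<xi> T)))"
    by (intro sum.cong) auto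
  also have "(\<Sum>\<xi>\<in>X. site_exp p S (\<lambda>T. H \<xi> T T)) = site_exp p S (\<lambda>T. F (run (Suc m) \<sigma> T))"
    unfolding site_exp_sum[symmetric] by (simp add: H)
  also have "(\<Sum>\<xi>\<in>X. site_exp p S (\<lambda>T. site_exp p S (H \<xi> T))) =
      site_exp p S (\<lambda>T. site_exp p S (\<lambda>U. F (run m (step \<sigma> T) U)))"
    unfolding site_exp_sum[symmetric] by (simp add: H)
  finally show ?thesis .
qed

text \<open>Lower bounds that hold in mean for one step propagate along the run. The claim covers
  every finite window beyond \<open>R\<close>, because the branches of the induction need different
  windows and have to share one.\<close>

lemma site_exp_run_ge:
  assumes p: "0 \<le> p" "p \<le> 1"
    and base: "\<And>\<sigma>. inv \<sigma> \<Longrightarrow> s 0 \<sigma> \<le> F \<sigma>"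
    and ind: "\<And>m \<sigma> S. inv \<sigma> \<Longrightarrow> finite S \<Longrightarrow> query \<sigma> \<subseteq> S \<Longrightarrow> s (Suc m) \<sigma> \<le> site_exp p S (\<lambda>T. s m (step \<sigma> T))"
    and \<sigma>: "inv \<sigma>"
  shows "\<exists>R. finite R \<and> R \<subseteq> fresh \<sigma> \<and>
    (\<forall>S. finite S \<longrightarrow> R \<subseteq> S \<longrightarrow> s m \<sigma> \<le> site_exp p S (\<lambda>T. F (run m \<sigma> T)))"
  using \<sigma>
proof (induction m arbitrary: \<sigma>)
  case 0
  then show ?case using base by (intro exI[of _ "{}"]) (auto simp: site_exp_const)
next
  case (Suc m)
  have "\<forall>\<xi>\<in>range (step \<sigma>). \<exists>R. finite R \<and> R \<subseteq> fresh \<xi> \<and>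
    (\<forall>S. finite S \<longrightarrow> R \<subseteq> S \<longrightarrow> s m \<xi> \<le> site_exp p S (\<lambda>T. F (run m \<xi> T)))"
    using Suc inv_step by auto
  then obtain R where R: "\<And>\<xi>. \<xi> \<in> range (step \<sigma>) \<Longrightarrow> finite (R \<xi>) \<and> R \<xi> \<subseteq> fresh \<xi> \<and>
    (\<forall>S. finite S \<longrightarrow> R \<xi> \<subseteq> S \<longrightarrow> s m \<xi> \<le> site_exp p S (\<lambda>T. F (run m \<xi> T)))"
    by metis
  define R' where "R' = query \<sigma> \<union> (\<Union>\<xi>\<in>range (step \<sigma>). R \<xi>)"
  have fin: "finite R'"
    unfolding R'_def
    using finite_query[OF Suc.prems] R by (intro finite_UnI finite_UN_I step_image_finite Suc.prems) auto
  have sub: "R' \<subseteq> fresh \<sigma>"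
    unfolding R'_def using query_fresh[OF Suc.prems] fresh_step[OF Suc.prems] R by blast
  have "s (Suc m) \<sigma> \<le> site_exp p S (\<lambda>T. F (run (Suc m) \<sigma> T))" if S: "finite S" "R' \<subseteq> S" for S
  proof -
    have "s (Suc m) \<sigma> \<le> site_exp p S (\<lambda>T. s m (step \<sigma> T))"
      using S Suc.prems by (intro ind) (auto simp: R'_def)
    also have "\<dots> \<le> site_exp p S (\<lambda>T. site_exp p S (\<lambda>U. F (run m (step \<sigma> T) U)))"
    proof (intro site_exp_mono p)
      fix T
      have "R (step \<sigma> T) \<subseteq> S" using S by (auto simp: R'_def)
      then show "s m (step \<sigma> T) \<le> site_exp p S (\<lambda>U. F (run m (step \<sigma> T) U))"
        using R[of "step \<sigma> T"] S by auto
    qed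
    also have "\<dots> = site_exp p S (\<lambda>T. F (run (Suc m) \<sigma> T))"
      by (rule site_exp_run_Suc[OF Suc.prems S(1), symmetric])
    finally show ?thesis .
  qed
  then show ?case using fin sub by blast
qed

end

section \<open>The lattice process explored level by level\<close>

definition inc :: "nat \<Rightarrow> (nat \<Rightarrow> int) \<Rightarrow> nat \<Rightarrow> int" where
  "inc k x = x(k := x k + 1)"

definition lattice_nbh :: "nat \<Rightarrow> (nat \<Rightarrow> int) set \<Rightarrow> (nat \<Rightarrow> int) set" where
  "lattice_nbh d A = (\<Union>k<d. inc k ` A)"

definition level :: "nat \<Rightarrow> (nat \<Rightarrow> int) \<Rightarrow> int" where
  "level d x = (\<Sum>i<d. x i)"

lemma inc_eq_iff: "inc k x = inc l x \<longleftrightarrow> k = l"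
  by (auto simp: inc_def fun_eq_iff split: if_splits)

lemma inc_minus: "inc k x - x = unit_vec k"
  by (auto simp: inc_def unit_vec_def fun_eq_iff)

lemma minus_unit_vec: "y - x = unit_vec k \<Longrightarrow> y = inc k x"
  by (auto simp: inc_def unit_vec_def fun_eq_iff split: if_splits)

lemma inc_Zd: "x \<in> Zd d \<Longrightarrow> k < d \<Longrightarrow> inc k x \<in> Zd d"
  by (auto simp: inc_def Zd_def)

lemma sum_inc: "finite I \<Longrightarrow> (\<Sum>i\<in>I. inc k x i) = (\<Sum>i\<in>I. x i) + (if k \<in> I then 1 else 0)"
proof -
  assume I: "finite I"
  have "(\<Sum>i\<in>I. inc k x i) = (\<Sum>i\<in>I. x i + (if i = k then 1 else 0))"
    by (intro sum.cong) (auto simp: inc_def)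
  then show ?thesis using I by (simp add: sum.distrib)
qed

lemma level_inc: "k < d \<Longrightarrow> level d (inc k x) = level d x + 1"
  by (simp add: level_def sum_inc)

lemma growth_map_lattice_nbh: "growth_map (lattice_nbh d)"
  by (auto simp: growth_map_def lattice_nbh_def mono_def)

lemma lattice_nbh_Zd: "A \<subseteq> Zd d \<Longrightarrow> lattice_nbh d A \<subseteq> Zd d"
  by (auto simp: lattice_nbh_def intro!: inc_Zd)

lemma lattice_nbh_level: "(\<And>x. x \<in> A \<Longrightarrow> level d x = n) \<Longrightarrow> y \<in> lattice_nbh d A \<Longrightarrow> level d y = n + 1"
  by (auto simp: lattice_nbh_def level_inc)

lemma origin_Zd: "origin \<in> Zd d"
  by (simp add: origin_def Zd_def)

lemma level_origin: "level d origin = 0"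
  by (simp add: level_def origin_def)

text \<open>The level is stored in the state because an empty set does not reveal it.\<close>

definition layer_step :: "nat \<Rightarrow> int \<times> (nat \<Rightarrow> int) set \<Rightarrow> (nat \<Rightarrow> int) set \<Rightarrow> int \<times> (nat \<Rightarrow> int) set" where
  "layer_step d \<sigma> T = (fst \<sigma> + 1, lattice_nbh d (snd \<sigma>) \<inter> T)"

interpretation layer: exploration "layer_step d" "\<lambda>\<sigma>. {x \<in> Zd d. fst \<sigma> < level d x}"
  "\<lambda>\<sigma>. lattice_nbh d (snd \<sigma>)" "\<lambda>\<sigma>. finite (snd \<sigma>) \<and> snd \<sigma> \<subseteq> Zd d \<and> (\<forall>x\<in>snd \<sigma>. level d x = fst \<sigma>)"
  for d
proof (unfold_locales, goal_cases)
  case (1 \<sigma>)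
  then show ?case using growth_mapD(2)[OF growth_map_lattice_nbh] by auto
next
  case (2 \<sigma> T)
  then show ?case by (auto simp: layer_step_def)
next
  case (3 \<sigma> T)
  then show ?case
    using growth_mapD(2)[OF growth_map_lattice_nbh, of "snd \<sigma>" d] lattice_nbh_Zd[of "snd \<sigma>" d]
      lattice_nbh_level[of "snd \<sigma>" d "fst \<sigma>"]
    by (auto simp: layer_step_def)
next
  case (4 \<sigma>)
  then show ?case
    using lattice_nbh_Zd[of "snd \<sigma>" d] lattice_nbh_level[of "snd \<sigma>" d "fst \<sigma>"] by auto
next
  case (5 \<sigma> T)
  then show ?case by (auto simp: layer_step_def)
next
  case (6 \<sigma> T U)
  then have "lattice_nbh d (snd \<sigma>) - {x \<in> Zd d. fst (layer_step d \<sigma> T) < level d x} = lattice_nbh d (snd \<sigma>)"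
    using lattice_nbh_level[of "snd \<sigma>" d "fst \<sigma>"] by (fastforce simp: layer_step_def)
  then show ?case using 6 by (auto simp: layer_step_def)
qed

text \<open>The state of the origin is not read here; it enters as the separate factor
  \<open>p\<close> in \<open>theta_site_limit\<close>.\<close>

definition wet :: "nat \<Rightarrow> nat \<Rightarrow> (nat \<Rightarrow> int) set \<Rightarrow> (nat \<Rightarrow> int) set" where
  "wet d m T = snd (layer.run d m (0, {origin}) T)"

lemma wet_0: "wet d 0 T = {origin}"
  by (simp add: wet_def)

lemma wet_Suc: "wet d (Suc m) T = lattice_nbh d (wet d m T) \<inter> T"
  by (simp only: wet_def layer.run_Suc_end layer_step_def) simp

lemma layer_inv_origin: "finite (snd (0::int, {origin})) \<and> snd (0::int, {origin}) \<subseteq> Zd d \<and>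
    (\<forall>x\<in>snd (0::int, {origin}). level d x = fst (0::int, {origin}))"
  by (simp add: origin_Zd level_origin)

lemma wet_finite: "finite (wet d m T)" and wet_Zd: "wet d m T \<subseteq> Zd d"
  unfolding wet_def using layer.inv_run[OF layer_inv_origin, of d m T] by auto

lemma wet_level: "x \<in> wet d m T \<Longrightarrow> level d x = int m"
proof (induction m arbitrary: x)
  case (Suc m)
  then show ?case using lattice_nbh_level[of "wet d m T" d "int m" x] by (auto simp: wet_Suc)
qed (simp add: wet_0 level_origin)

lemma wet_mono: "T \<subseteq> U \<Longrightarrow> wet d m T \<subseteq> wet d m U"
proof (induction m)
  case (Suc m)
  then show ?case using growth_mapD(1)[OF growth_map_lattice_nbh, of "wet d m T" "wet d m U" d]
    by (auto simp: wet_Suc)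
qed (simp add: wet_0)

lemma wet_empty_mono: "wet d m T = {} \<Longrightarrow> m \<le> n \<Longrightarrow> wet d n T = {}"
proof (induction n)
  case (Suc n)
  then show ?case
    by (cases "m = Suc n") (auto simp: le_Suc_eq wet_Suc[of d n] lattice_nbh_def)
qed simp

lemma wet_depends_finite:
  "\<exists>R. finite R \<and> R \<subseteq> {x \<in> Zd d. 0 < level d x} \<and> (\<forall>T. wet d m (T \<inter> R) = wet d m T)"
proof -
  obtain R where "finite R" "R \<subseteq> {x \<in> Zd d. fst (0::int, {origin}) < level d x}"
    "\<And>T. layer.run d m (0, {origin}) (T \<inter> R) = layer.run d m (0, {origin}) T"
    using layer.run_depends_finite[OF layer_inv_origin, of d m] by blast
  then show ?thesis unfolding wet_def fst_conv by (intro exI[of _ R]) simp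
qed

lemma site_exp_layer_step:
  assumes "finite S" "lattice_nbh d A \<subseteq> S"
  shows "site_exp p S (\<lambda>T. g (lattice_nbh d A \<inter> T)) = site_exp p (lattice_nbh d A) g"
proof -
  have "site_exp p S (\<lambda>T. g (lattice_nbh d A \<inter> T)) =
      site_exp p (S \<inter> lattice_nbh d A) (\<lambda>T. g (lattice_nbh d A \<inter> T))"
    using assms by (intro site_exp_depends) (auto simp: Int_ac)
  also have "S \<inter> lattice_nbh d A = lattice_nbh d A" using assms by auto
  also have "site_exp p (lattice_nbh d A) (\<lambda>T. g (lattice_nbh d A \<inter> T)) = site_exp p (lattice_nbh d A) g"
    by (intro site_exp_cong arg_cong[of _ _ g]) auto
  finally show ?thesis .
qed

text \<open>For this exploration one step preserves the mean exactly, so the one-sided principle,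
  applied to the indicator and to its negative, yields equality.\<close>

lemma site_exp_wet:
  assumes p: "0 \<le> p" "p \<le> 1"
  shows "\<exists>R. finite R \<and> R \<subseteq> {x \<in> Zd d. 0 < level d x} \<and> (\<forall>S. finite S \<longrightarrow> R \<subseteq> S \<longrightarrow>
    site_exp p S (\<lambda>T. if wet d m T = {} then 0 else 1) = survival (lattice_nbh d) p m {origin})"
proof -
  let ?F = "\<lambda>\<sigma> :: int \<times> (nat \<Rightarrow> int) set. if snd \<sigma> = {} then 0 else (1::real)"
  let ?s = "\<lambda>m (\<sigma> :: int \<times> (nat \<Rightarrow> int) set). survival (lattice_nbh d) p m (snd \<sigma>)"
  have 1: "\<exists>R. finite R \<and> R \<subseteq> {x \<in> Zd d. fst (0::int, {origin}) < level d x} \<and>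
    (\<forall>S. finite S \<longrightarrow> R \<subseteq> S \<longrightarrow> ?s m (0, {origin}) \<le> site_exp p S (\<lambda>T. ?F (layer.run d m (0, {origin}) T)))"
    by (rule layer.site_exp_run_ge[OF p _ _ layer_inv_origin])
      (simp_all add: layer_step_def site_exp_layer_step)
  have 2: "\<exists>R. finite R \<and> R \<subseteq> {x \<in> Zd d. fst (0::int, {origin}) < level d x} \<and>
    (\<forall>S. finite S \<longrightarrow> R \<subseteq> S \<longrightarrow> - ?s m (0, {origin}) \<le> site_exp p S (\<lambda>T. - ?F (layer.run d m (0, {origin}) T)))"
    by (rule layer.site_exp_run_ge[OF p _ _ layer_inv_origin, where s = "\<lambda>m \<sigma>. - ?s m \<sigma>"])
      (simp_all add: layer_step_def site_exp_layer_step site_exp_minus)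
  obtain R1 where R1: "finite R1" "R1 \<subseteq> {x \<in> Zd d. 0 < level d x}"
    "\<And>S. finite S \<Longrightarrow> R1 \<subseteq> S \<Longrightarrow> ?s m (0, {origin}) \<le> site_exp p S (\<lambda>T. ?F (layer.run d m (0, {origin}) T))"
    using 1 unfolding fst_conv by blast
  obtain R2 where R2: "finite R2" "R2 \<subseteq> {x \<in> Zd d. 0 < level d x}"
    "\<And>S. finite S \<Longrightarrow> R2 \<subseteq> S \<Longrightarrow> - ?s m (0, {origin}) \<le> site_exp p S (\<lambda>T. - ?F (layer.run d m (0, {origin}) T))"
    using 2 unfolding fst_conv by blast
  show ?thesis
  proof (intro exI[of _ "R1 \<union> R2"] conjI allI impI)
    fix S assume "finite S" "R1 \<union> R2 \<subseteq> S"
    then show "site_exp p S (\<lambda>T. if wet d m T = {} then 0 else 1) = survival (lattice_nbh d) p m {origin}"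
      using R1(3)[of S] R2(3)[of S] unfolding site_exp_minus wet_def by (intro antisym) auto
  qed (use R1 R2 in auto)
qed

section \<open>The percolation probability as a limit\<close>

lemma prob_space_site_percolation: "prob_space (site_percolation d p)"
  unfolding site_percolation_def by (intro prob_space_PiM measure_pmf.prob_space_axioms)

definition open_sites :: "nat \<Rightarrow> ((nat \<Rightarrow> int) \<Rightarrow> bool) \<Rightarrow> (nat \<Rightarrow> int) set" where
  "open_sites d \<omega> = {x \<in> Zd d. \<omega> x}"

lemma cylinder_site_percolation:
  assumes p: "0 \<le> p" "p \<le> 1" and S: "finite S" "S \<subseteq> Zd d" and T: "T \<subseteq> S"
  defines "M \<equiv> site_percolation d p"
  shows "{\<omega> \<in> space M. open_sites d \<omega> \<inter> S = T} \<in> sets M"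
    and "measure M {\<omega> \<in> space M. open_sites d \<omega> \<inter> S = T} = p ^ card T * (1 - p) ^ card (S - T)"
proof -
  interpret product_prob_space "\<lambda>_. measure_pmf (bernoulli_pmf p)" "Zd d"
    by unfold_locales
  have M: "M = PiM (Zd d) (\<lambda>_. measure_pmf (bernoulli_pmf p))"
    by (simp add: M_def site_percolation_def)
  \<comment> \<open>On the right \<open>{x \<in> T}\<close> is the singleton of a truth value, so
    the event is a box.\<close>
  have eq: "{\<omega> \<in> space M. open_sites d \<omega> \<inter> S = T} = {\<omega> \<in> space M. \<forall>x\<in>S. \<omega> x \<in> {x \<in> T}}"
    using S T by (auto simp: open_sites_def)
  show "{\<omega> \<in> space M. open_sites d \<omega> \<inter> S = T} \<in> sets M"
    unfolding eq
  proof (intro sets.sets_Collect_finite_All S)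
    fix x assume "x \<in> S"
    then have "(\<lambda>\<omega>. \<omega> x) \<in> measurable M (measure_pmf (bernoulli_pmf p))"
      unfolding M using S by (intro measurable_component_singleton) auto
    from measurable_sets[OF this, of "{x \<in> T}"]
    have "(\<lambda>\<omega>. \<omega> x) -` {x \<in> T} \<inter> space M \<in> sets M" by simp
    also have "(\<lambda>\<omega>. \<omega> x) -` {x \<in> T} \<inter> space M = {\<omega> \<in> space M. \<omega> x \<in> {x \<in> T}}" by auto
    finally show "{\<omega> \<in> space M. \<omega> x \<in> {x \<in> T}} \<in> sets M" .
  qed
  have "emeasure M {\<omega> \<in> space M. open_sites d \<omega> \<inter> S = T} =
      (\<Prod>x\<in>S. emeasure (measure_pmf (bernoulli_pmf p)) {x \<in> T})"
    unfolding eq unfolding M using S by (intro emeasure_PiM_Collect) auto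
  also have "\<dots> = (\<Prod>x\<in>S. ennreal (if x \<in> T then p else 1 - p))"
    using p by (intro prod.cong refl) (auto simp: emeasure_pmf_single)
  also have "\<dots> = ennreal (\<Prod>x\<in>S. if x \<in> T then p else 1 - p)"
    using p by (intro prod_ennreal) auto
  also have "(\<Prod>x\<in>S. if x \<in> T then p else 1 - p) = (\<Prod>x\<in>S \<inter> T. p) * (\<Prod>x\<in>S - T. 1 - p)"
    using S by (simp add: prod.If_cases Diff_eq)
  also have "\<dots> = p ^ card T * (1 - p) ^ card (S - T)"
    using T by (simp add: Int_absorb1)
  finally show "measure M {\<omega> \<in> space M. open_sites d \<omega> \<inter> S = T} = p ^ card T * (1 - p) ^ card (S - T)"
    using p by (simp add: measure_def)
qed

lemma finite_event_site_percolation: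
  assumes p: "0 \<le> p" "p \<le> 1" and S: "finite S" "S \<subseteq> Zd d"
    and dep: "\<And>T. T \<subseteq> Zd d \<Longrightarrow> P (T \<inter> S) = P T"
  defines "M \<equiv> site_percolation d p"
  shows "{\<omega> \<in> space M. P (open_sites d \<omega>)} \<in> sets M"
    and "measure M {\<omega> \<in> space M. P (open_sites d \<omega>)} = site_exp p S (\<lambda>T. if P T then 1 else 0)"
proof -
  interpret prob_space M unfolding M_def by (rule prob_space_site_percolation)
  define I where "I = {T \<in> Pow S. P T}"
  define C where "C T = {\<omega> \<in> space M. open_sites d \<omega> \<inter> S = T}" for T
  have "P (open_sites d \<omega>) \<longleftrightarrow> open_sites d \<omega> \<inter> S \<in> I" for \<omega>
    using dep[of "open_sites d \<omega>"] by (auto simp: I_def open_sites_def)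
  then have eq: "{\<omega> \<in> space M. P (open_sites d \<omega>)} = (\<Union>T\<in>I. C T)"
    by (auto simp: C_def)
  have fin: "finite I" using S by (simp add: I_def)
  have sets: "C T \<in> sets M" if "T \<in> I" for T
    using cylinder_site_percolation(1)[OF p S, of T] that by (simp add: C_def M_def I_def)
  then show "{\<omega> \<in> space M. P (open_sites d \<omega>)} \<in> sets M"
    unfolding eq using fin by auto
  have "measure M (\<Union>T\<in>I. C T) = (\<Sum>T\<in>I. measure M (C T))"
    using fin sets by (intro finite_measure_finite_Union) (auto simp: disjoint_family_on_def C_def)
  also have "\<dots> = (\<Sum>T\<in>I. p ^ card T * (1 - p) ^ card (S - T))"
    using cylinder_site_percolation(2)[OF p S] by (intro sum.cong) (auto simp: C_def M_def I_def)
  also have "\<dots> = site_exp p S (\<lambda>T. if P T then 1 else 0)"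
    unfolding site_exp_def I_def using S by (intro sum.mono_neutral_cong_left) auto
  finally show "measure M {\<omega> \<in> space M. P (open_sites d \<omega>)} = site_exp p S (\<lambda>T. if P T then 1 else 0)"
    unfolding eq .
qed

lemma wet_iff_path:
  assumes o: "origin \<in> T"
  shows "x \<in> wet d m T \<longleftrightarrow> (\<exists>xs. length xs = Suc m \<and> hd xs = origin \<and> last xs = x \<and> set xs \<subseteq> T \<and>
    (\<forall>j\<in>{1..<length xs}. xs ! j - xs ! (j - 1) \<in> unit_vec ` {..<d}))"
proof (induction m arbitrary: x)
  case 0
  show ?case
  proof
    assume "x \<in> wet d 0 T"
    then show "\<exists>xs. length xs = Suc 0 \<and> hd xs = origin \<and> last xs = x \<and> set xs \<subseteq> T \<and>
       (\<forall>j\<in>{1..<length xs}. xs ! j - xs ! (j - 1) \<in> unit_vec ` {..<d})"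
      using o by (intro exI[of _ "[origin]"]) (auto simp: wet_0)
  qed (auto simp: wet_0 length_Suc_conv)
next
  case (Suc m)
  show ?case
  proof
    assume "x \<in> wet d (Suc m) T"
    then obtain k y where y: "k < d" "y \<in> wet d m T" "x = inc k y" "x \<in> T"
      by (auto simp: wet_Suc lattice_nbh_def)
    then obtain xs where xs: "length xs = Suc m" "hd xs = origin" "last xs = y" "set xs \<subseteq> T"
      "\<And>j. j \<in> {1..<length xs} \<Longrightarrow> xs ! j - xs ! (j - 1) \<in> unit_vec ` {..<d}"
      using Suc.IH[of y] by blast
    have "(xs @ [x]) ! j - (xs @ [x]) ! (j - 1) \<in> unit_vec ` {..<d}" if "j \<in> {1..<length (xs @ [x])}" for j
    proof (cases "j = length xs")
      case True
      have "xs \<noteq> []" using xs(1) by auto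
      then have "(xs @ [x]) ! j = x" "(xs @ [x]) ! (j - 1) = y"
        using last_conv_nth[of xs] xs(3) True by (simp_all add: nth_append)
      then show ?thesis using y by (auto simp: inc_minus)
    next
      case False
      then show ?thesis using xs(5)[of j] that by (auto simp: nth_append)
    qed
    then show "\<exists>xs. length xs = Suc (Suc m) \<and> hd xs = origin \<and> last xs = x \<and> set xs \<subseteq> T \<and>
       (\<forall>j\<in>{1..<length xs}. xs ! j - xs ! (j - 1) \<in> unit_vec ` {..<d})"
      using xs y by (intro exI[of _ "xs @ [x]"]) (auto simp: hd_append)
  next
    assume "\<exists>xs. length xs = Suc (Suc m) \<and> hd xs = origin \<and> last xs = x \<and> set xs \<subseteq> T \<and>
       (\<forall>j\<in>{1..<length xs}. xs ! j - xs ! (j - 1) \<in> unit_vec ` {..<d})"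
    then obtain xs where xs: "length xs = Suc (Suc m)" "hd xs = origin" "last xs = x" "set xs \<subseteq> T"
      "\<And>j. j \<in> {1..<length xs} \<Longrightarrow> xs ! j - xs ! (j - 1) \<in> unit_vec ` {..<d}" by blast
    define ys where "ys = butlast xs"
    have ys: "xs = ys @ [x]" "length ys = Suc m"
      using xs(1,3) by (auto simp: ys_def) (metis append_butlast_last_id list.size(3) nat.distinct(1))
    have "ys ! j - ys ! (j - 1) \<in> unit_vec ` {..<d}" if "j \<in> {1..<length ys}" for j
    proof -
      have "j < length ys" "j - 1 < length ys" using that by auto
      then have "xs ! j = ys ! j" "xs ! (j - 1) = ys ! (j - 1)"
        unfolding ys(1) nth_append by (simp_all only: if_True)
      then show ?thesis using xs(5)[of j] that ys by simp
    qed
    then have "last ys \<in> wet d m T"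
    proof -
      have "ys \<noteq> []" using ys(2) by auto
      then have "hd ys = origin" "set ys \<subseteq> T" using xs(2,4) ys(1) by auto
      then show ?thesis using \<open>\<And>j. j \<in> {1..<length ys} \<Longrightarrow> ys ! j - ys ! (j - 1) \<in> unit_vec ` {..<d}\<close> ys(2)
        unfolding Suc.IH by blast
    qed
    moreover have "xs ! Suc m - xs ! m \<in> unit_vec ` {..<d}"
      using xs(5)[of "Suc m"] ys by simp
    then have "x - last ys \<in> unit_vec ` {..<d}"
      using ys by (cases ys rule: rev_cases) (auto simp: nth_append)
    then obtain k where "k < d" "x = inc k (last ys)"
      by (auto dest: minus_unit_vec)
    ultimately show "x \<in> wet d (Suc m) T"
      using xs(4) ys by (auto simp: wet_Suc lattice_nbh_def)
  qed
qed

lemma oriented_cluster_eq: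
  "oriented_cluster d \<omega> = (if origin \<in> open_sites d \<omega> then (\<Union>m. wet d m (open_sites d \<omega>)) else {})"
proof (cases "origin \<in> open_sites d \<omega>")
  case True
  have sub: "set xs \<subseteq> open_sites d \<omega> \<longleftrightarrow> set xs \<subseteq> Zd d \<and> (\<forall>x\<in>set xs. \<omega> x)" for xs
    by (auto simp: open_sites_def)
  have "x \<in> oriented_cluster d \<omega> \<longleftrightarrow> (\<exists>m. x \<in> wet d m (open_sites d \<omega>))" for x
  proof
    assume "x \<in> oriented_cluster d \<omega>"
    then obtain xs where xs: "oriented_open_path d \<omega> xs" "hd xs = origin" "last xs = x"
      by (auto simp: oriented_cluster_def)
    then obtain m where "length xs = Suc m"
      by (cases xs) (auto simp: oriented_open_path_def)
    then show "\<exists>m. x \<in> wet d m (open_sites d \<omega>)"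
      using xs wet_iff_path[OF True, of x d m] sub by (auto simp: oriented_open_path_def)
  next
    assume "\<exists>m. x \<in> wet d m (open_sites d \<omega>)"
    then obtain m xs where "length xs = Suc m" "hd xs = origin" "last xs = x" "set xs \<subseteq> open_sites d \<omega>"
      "\<forall>j\<in>{1..<length xs}. xs ! j - xs ! (j - 1) \<in> unit_vec ` {..<d}"
      using wet_iff_path[OF True] by blast
    then show "x \<in> oriented_cluster d \<omega>"
      using sub by (auto simp: oriented_cluster_def oriented_open_path_def intro!: exI[of _ xs])
  qed
  then show ?thesis using True by auto
next
  case False
  have "hd xs \<in> open_sites d \<omega>" if "oriented_open_path d \<omega> xs" for xs
    using that hd_in_set[of xs] by (auto simp: oriented_open_path_def open_sites_def)
  then show ?thesis using False unfolding oriented_cluster_def by fastforce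
qed

text \<open>Wet levels are finite, and once empty they stay empty; conversely, vertices chosen on
  different levels are distinct.\<close>

lemma infinite_oriented_cluster_iff:
  "infinite (oriented_cluster d \<omega>) \<longleftrightarrow>
     (\<forall>m. origin \<in> open_sites d \<omega> \<and> wet d m (open_sites d \<omega>) \<noteq> {})"
proof (cases "origin \<in> open_sites d \<omega>")
  case True
  let ?W = "\<lambda>m. wet d m (open_sites d \<omega>)"
  show ?thesis
  proof
    assume inf: "infinite (oriented_cluster d \<omega>)"
    have "?W m \<noteq> {}" for m
    proof
      assume "?W m = {}"
      then have W: "?W n = {}" if "m \<le> n" for n using wet_empty_mono that by blast
      have "(\<Union>n. ?W n) \<subseteq> (\<Union>n<m. ?W n)"
      proof (intro UN_least)
        fix n show "?W n \<subseteq> (\<Union>n<m. ?W n)"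
          using W[of n] by (cases "m \<le> n") (simp, blast dest: leI)
      qed
      moreover have "finite (\<Union>n<m. ?W n)" using wet_finite by auto
      ultimately have "finite (\<Union>n. ?W n)" by (rule finite_subset)
      then show False using inf True by (simp add: oriented_cluster_eq)
    qed
    then show "\<forall>m. origin \<in> open_sites d \<omega> \<and> ?W m \<noteq> {}" using True by auto
  next
    assume W: "\<forall>m. origin \<in> open_sites d \<omega> \<and> ?W m \<noteq> {}"
    then have "\<forall>m. \<exists>x. x \<in> ?W m" by blast
    from choice[OF this] obtain x where x: "\<And>m. x m \<in> ?W m" by blast
    have "inj x"
    proof (rule injI)
      fix m n assume eq: "x m = x n"
      have "int m = level d (x m)" by (rule wet_level[OF x, symmetric])
      also have "\<dots> = int n" unfolding eq by (rule wet_level[OF x])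
      finally show "m = n" by simp
    qed
    then have "infinite (range x)" by (rule range_inj_infinite)
    moreover have "range x \<subseteq> oriented_cluster d \<omega>"
      unfolding oriented_cluster_eq if_P[OF True] using x by blast
    ultimately show "infinite (oriented_cluster d \<omega>)" using finite_subset by blast
  qed
qed (auto simp: oriented_cluster_eq)

lemma theta_site_limit:
  assumes p: "0 \<le> p" "p \<le> 1"
  shows "(\<lambda>m. p * survival (lattice_nbh d) p m {origin}) \<longlonglongrightarrow> theta_site d p"
    and "theta_site d p \<le> p * survival (lattice_nbh d) p m {origin}"
proof -
  let ?M = "site_percolation d p"
  interpret prob_space ?M by (rule prob_space_site_percolation)
  define P where "P m T \<longleftrightarrow> origin \<in> T \<and> wet d m T \<noteq> {}" for m T
  define E where "E m = {\<omega> \<in> space ?M. P m (open_sites d \<omega>)}" for m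
  have E: "E m \<in> sets ?M \<and> measure ?M (E m) = p * survival (lattice_nbh d) p m {origin}" for m
  proof -
    obtain R1 where R1: "finite R1" "R1 \<subseteq> {x \<in> Zd d. 0 < level d x}" "\<And>T. wet d m (T \<inter> R1) = wet d m T"
      using wet_depends_finite[of d m] by blast
    obtain R2 where R2: "finite R2" "R2 \<subseteq> {x \<in> Zd d. 0 < level d x}"
      "\<And>S. finite S \<Longrightarrow> R2 \<subseteq> S \<Longrightarrow>
        site_exp p S (\<lambda>T. if wet d m T = {} then 0 else 1) = survival (lattice_nbh d) p m {origin}"
      using site_exp_wet[OF p, of d m] by blast
    define S where "S = R1 \<union> R2"
    \<comment> \<open>Only positive levels are read, so the state of the origin factors out.\<close>
    have oS: "origin \<notin> S" using R1 R2 by (auto simp: S_def level_origin)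
    have S: "finite (insert origin S)" "insert origin S \<subseteq> Zd d" "finite S"
      using R1 R2 origin_Zd by (auto simp: S_def)
    have wS: "wet d m (T \<inter> U) = wet d m T" if "R1 \<subseteq> U" for T U
      using R1(3)[of T] R1(3)[of "T \<inter> U"] that by (metis Int_absorb1 Int_assoc inf_commute)
    have dep: "P m (T \<inter> insert origin S) = P m T" for T
      using wS[of "insert origin S" T] by (auto simp: P_def S_def)
    have wo: "wet d m (insert origin T) = wet d m T" if "T \<subseteq> S" for T
      using wS[of S "insert origin T"] that oS by (simp add: S_def[symmetric] Int_absorb2) (simp add: S_def)
    have "site_exp p (insert origin S) (\<lambda>T. if P m T then 1 else 0) =
        p * site_exp p S (\<lambda>T. if P m (insert origin T) then 1 else 0) +
        (1 - p) * site_exp p S (\<lambda>T. if P m T then 1 else 0)"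
      by (rule site_exp_insert[OF S(3) oS])
    also have "site_exp p S (\<lambda>T. if P m T then 1 else 0) = site_exp p S (\<lambda>T. 0)"
      using oS by (intro site_exp_cong) (auto simp: P_def)
    also have "\<dots> = 0" using S by (simp add: site_exp_const)
    also have "site_exp p S (\<lambda>T. if P m (insert origin T) then 1 else 0) =
        site_exp p S (\<lambda>T. if wet d m T = {} then 0 else 1)"
      using wo by (intro site_exp_cong) (auto simp: P_def)
    also have "\<dots> = survival (lattice_nbh d) p m {origin}"
      using S R2(3)[of S] by (auto simp: S_def)
    finally show ?thesis
      using finite_event_site_percolation[OF p S(1,2), of "P m"] dep by (simp add: E_def)
  qed
  have "decseq E"
    unfolding decseq_def E_def P_def using wet_empty_mono by blast
  moreover have "range E \<subseteq> sets ?M" using E by auto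
  ultimately have "(\<lambda>m. measure ?M (E m)) \<longlonglongrightarrow> measure ?M (\<Inter>m. E m)"
    by (rule finite_Lim_measure_decseq[rotated])
  moreover have I: "(\<Inter>m. E m) = {\<omega> \<in> space ?M. infinite (oriented_cluster d \<omega>)}"
    by (auto simp: E_def P_def infinite_oriented_cluster_iff)
  ultimately show "(\<lambda>m. p * survival (lattice_nbh d) p m {origin}) \<longlonglongrightarrow> theta_site d p"
    using E by (simp add: theta_site_def)
  have "measure ?M (\<Inter>m. E m) \<le> measure ?M (E m)"
    using E by (intro finite_measure_mono) auto
  then show "theta_site d p \<le> p * survival (lattice_nbh d) p m {origin}"
    using E I by (simp add: theta_site_def)
qed

section \<open>Even dimensions\<close>

lemma site_exp_empty_prob:
  "finite S \<Longrightarrow> site_exp p S (\<lambda>T. if T = {} then a else b) = (1 - p) ^ card S * a + (1 - (1 - p) ^ card S) * b"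
  by (induction S rule: finite_induct) (simp, simp add: site_exp_insert site_exp_const, simp add: algebra_simps)

text \<open>A point of \<open>R\<close> is missed only if all of its preimages, at least
  \<open>k\<close> many, are closed. Fibres are disjoint, which makes these misses independent;
  further preimages and images outside \<open>R\<close> only help a monotone
  \<open>g\<close>.\<close>

lemma site_exp_fibres:
  assumes p: "0 \<le> p" "p \<le> 1" and "finite_mono g" "finite R" "finite S"
    and "\<And>z. z \<in> R \<Longrightarrow> k \<le> card {w \<in> S. f w = z}"
  shows "site_exp (1 - (1 - p) ^ k) R g \<le> site_exp p S (\<lambda>T. g (f ` T))"
  using assms(4,3,5,6)
proof (induction R arbitrary: g S rule: finite_induct)
  case empty
  have "site_exp p S (\<lambda>_. g {}) \<le> site_exp p S (\<lambda>T. g (f ` T))"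
    using empty p finite_subset by (intro site_exp_mono finite_monoD[OF empty.prems(1)]) auto
  then show ?case using empty by (simp add: site_exp_const)
next
  case (insert z R)
  define Q where "Q = {w \<in> S. f w = z}"
  define S' where "S' = S - Q"
  have fin: "finite S'" "finite Q" and S: "S = S' \<union> Q" and disj: "S' \<inter> Q = {}"
    using insert.prems by (auto simp: S'_def Q_def)
  have k: "k \<le> card Q" using insert.prems(3)[of z] by (simp add: Q_def)
  define a where "a = 1 - (1 - p) ^ k"
  have a: "0 \<le> a" "a \<le> 1" using p by (auto simp: a_def power_le_one)
  define g' where "g' B = a * g (insert z B) + (1 - a) * g B" for B
  have g': "finite_mono g'"
    unfolding finite_mono_def g'_def
    using a by (intro allI impI add_mono mult_left_mono finite_monoD[OF insert.prems(1)]) auto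
  have card': "k \<le> card {w \<in> S'. f w = y}" if "y \<in> R" for y
  proof -
    have "{w \<in> S'. f w = y} = {w \<in> S. f w = y}" using that insert.hyps by (auto simp: S'_def Q_def)
    then show ?thesis using insert.prems(3)[of y] that by simp
  qed
  have "site_exp a (insert z R) g = site_exp a R g'"
    using insert.hyps by (simp add: site_exp_insert g'_def[abs_def] site_exp_add site_exp_cmult)
  also have "\<dots> \<le> site_exp p S' (\<lambda>T. g' (f ` T))"
    unfolding a_def using insert.IH[OF g' fin(1) card'] by simp
  also have "\<dots> \<le> site_exp p S' (\<lambda>T. site_exp p Q (\<lambda>U. g (f ` (T \<union> U))))"
  proof (intro site_exp_mono p)
    fix T assume "T \<subseteq> S'"
    then have finT: "finite (f ` T)" using fin finite_subset by blast
    have "(1 - p) ^ card Q \<le> (1 - p) ^ k" using p k by (intro power_decreasing) auto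
    moreover have "g (f ` T) \<le> g (insert z (f ` T))"
      using finT by (intro finite_monoD[OF insert.prems(1)]) auto
    ultimately have "0 \<le> ((1 - p) ^ k - (1 - p) ^ card Q) * (g (insert z (f ` T)) - g (f ` T))"
      by (intro mult_nonneg_nonneg) auto
    then have "g' (f ` T) \<le> (1 - p) ^ card Q * g (f ` T) + (1 - (1 - p) ^ card Q) * g (insert z (f ` T))"
      by (simp add: g'_def a_def algebra_simps)
    also have "\<dots> = site_exp p Q (\<lambda>U. if U = {} then g (f ` T) else g (insert z (f ` T)))"
      by (simp add: site_exp_empty_prob fin)
    also have "\<dots> = site_exp p Q (\<lambda>U. g (f ` (T \<union> U)))"
    proof (intro site_exp_cong)
      fix U assume U: "U \<subseteq> Q"
      show "(if U = {} then g (f ` T) else g (insert z (f ` T))) = g (f ` (T \<union> U))"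
      proof (cases "U = {}")
        case False
        then have "f ` (T \<union> U) = insert z (f ` T)" using U by (auto simp: Q_def)
        then show ?thesis using False by simp
      qed simp
    qed
    finally show "g' (f ` T) \<le> site_exp p Q (\<lambda>U. g (f ` (T \<union> U)))" .
  qed
  also have "\<dots> = site_exp p S (\<lambda>T. g (f ` T))"
    unfolding S using fin disj by (rule site_exp_union[symmetric])
  finally show ?case by (simp add: a_def)
qed

text \<open>In \<open>\<int>\<^bsup>2k\<^esup>\<close>, \<open>k\<close> of the steps raise the half sum and the \<open>k\<close> other ones keep it, as the two steps of the
  planar process do.\<close>
definition half_sum :: "nat \<Rightarrow> (nat \<Rightarrow> int) \<Rightarrow> nat" where
  "half_sum k x = nat (\<Sum>i<k. x i)"

lemma survival_half_sum:
  assumes p: "0 \<le> p" "p \<le> 1" and A: "finite A" "\<And>x. x \<in> A \<Longrightarrow> 0 \<le> (\<Sum>i<k. x i)"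
  shows "survival nat_nbh (1 - (1 - p) ^ k) m (half_sum k ` A) \<le> survival (lattice_nbh (2 * k)) p m A"
  using A
proof (induction m arbitrary: A)
  case (Suc m)
  let ?a = "1 - (1 - p) ^ k"
  let ?N = "lattice_nbh (2 * k) A"
  have a: "0 \<le> ?a" "?a \<le> 1" using p by (auto simp: power_le_one)
  have fin: "finite ?N" using Suc.prems growth_mapD(2)[OF growth_map_lattice_nbh] by auto
  have pos: "0 \<le> (\<Sum>i<k. x i)" if "x \<in> ?N" for x
    using that Suc.prems(2) by (auto simp: lattice_nbh_def sum_inc add_nonneg_nonneg)
  have fibre: "k \<le> card {w \<in> ?N. half_sum k w = z}" if z: "z \<in> nat_nbh (half_sum k ` A)" for z
  proof -
    obtain x where x: "x \<in> A" "z = half_sum k x \<or> z = Suc (half_sum k x)"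
      using z by (auto simp: nat_nbh_def)
    define I where "I = (if z = half_sum k x then {k..<2 * k} else {..<k})"
    have "inc i x \<in> {w \<in> ?N. half_sum k w = z}" if "i \<in> I" for i
      using that x Suc.prems(2)[OF x(1)]
      by (auto simp: I_def lattice_nbh_def half_sum_def sum_inc nat_add_distrib split: if_splits)
    then have "(\<lambda>i. inc i x) ` I \<subseteq> {w \<in> ?N. half_sum k w = z}" by auto
    then have "card ((\<lambda>i. inc i x) ` I) \<le> card {w \<in> ?N. half_sum k w = z}"
      using fin by (intro card_mono) auto
    moreover have "card ((\<lambda>i. inc i x) ` I) = k"
      by (subst card_image) (auto simp: inj_on_def inc_eq_iff I_def)
    ultimately show ?thesis by simp
  qed
  have "site_exp ?a (nat_nbh (half_sum k ` A)) (survival nat_nbh ?a m) \<le>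
      site_exp p ?N (\<lambda>T. survival nat_nbh ?a m (half_sum k ` T))"
    using Suc.prems fin p a fibre growth_mapD(2)[OF growth_map_nat_nbh]
    by (intro site_exp_fibres finite_mono_survival growth_map_nat_nbh) auto
  also have "\<dots> \<le> site_exp p ?N (survival (lattice_nbh (2 * k)) p m)"
    using fin pos p finite_subset by (intro site_exp_mono Suc.IH) blast+
  finally show ?case by simp
qed simp

lemma survival_even:
  assumes "1 - (1 / 4) powr (1 / real k) \<le> p" "p \<le> 1" "k \<ge> 1"
  shows "2 / 3 \<le> survival (lattice_nbh (2 * k)) p m {origin}"
proof -
  have p0: "0 \<le> p"
    using assms powr_le_one_le[of "1/4" "1 / real k"] powr_le1[of "1 / real k" "1/4"] by auto
  \<comment> \<open>The origin of the exponent: \<open>k\<close> offers fail together with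
    probability at most 1/4.\<close>
  have "(1 - p) ^ k \<le> ((1 / 4) powr (1 / real k)) ^ k"
    using assms by (intro power_mono) auto
  also have "\<dots> = 1 / 4" using assms by (simp flip: powr_realpow add: powr_powr)
  finally have "3 / 4 \<le> 1 - (1 - p) ^ k" by simp
  moreover have "1 - (1 - p) ^ k \<le> 1" using assms by simp
  ultimately have "2 / 3 \<le> survival nat_nbh (1 - (1 - p) ^ k) m {0}"
    by (rule survival_nat_nbh_singleton)
  also have "{0} = half_sum k ` {origin}" by (simp add: half_sum_def origin_def)
  also have "survival nat_nbh (1 - (1 - p) ^ k) m (half_sum k ` {origin}) \<le> survival (lattice_nbh (2 * k)) p m {origin}"
    using p0 assms by (intro survival_half_sum) (auto simp: origin_def)
  finally show ?thesis .
qed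

section \<open>From survival bounds to critical points\<close>

lemma theta_site_pos:
  assumes "0 < p" "p \<le> 1" "0 < c" "\<And>m. c \<le> survival (lattice_nbh d) p m {origin}"
  shows "0 < theta_site d p"
proof -
  have "p * c \<le> theta_site d p"
    using assms by (intro LIMSEQ_le_const[OF theta_site_limit(1)]) auto
  moreover have "0 < p * c" using assms by simp
  ultimately show ?thesis by linarith
qed

lemma theta_site_zero: "theta_site d 0 = 0"
  using theta_site_limit(1)[of 0 d] LIMSEQ_unique[of "\<lambda>_. 0::real" "theta_site d 0" 0] by auto

lemma theta_site_nonneg: "0 \<le> theta_site d p"
  by (simp add: theta_site_def)

lemma pc_site_le:
  assumes "\<And>p. b < p \<Longrightarrow> 0 \<le> p \<Longrightarrow> p \<le> 1 \<Longrightarrow> theta_site d p \<noteq> 0"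
  shows "pc_site d \<le> b"
  unfolding pc_site_def
proof (rule cSup_least)
  show "{p \<in> {0..1}. theta_site d p = 0} \<noteq> {}" using theta_site_zero by (auto intro!: exI[of _ 0])
  show "p \<le> b" if "p \<in> {p \<in> {0..1}. theta_site d p = 0}" for p
    using that assms[of p] by (cases "p \<le> b") auto
qed

lemma le_pc_site:
  assumes "0 \<le> p" "p \<le> 1" "theta_site d p = 0"
  shows "p \<le> pc_site d"
  unfolding pc_site_def using assms by (intro cSup_upper) (auto intro!: bdd_aboveI[of _ 1])

lemma pc_site_even:
  assumes "d \<ge> 1" "even d"
  shows "pc_site d \<le> 1 - (1 / 4) powr (2 / real d)"
proof (rule pc_site_le)
  fix p assume p: "1 - (1 / 4) powr (2 / real d) < p" "0 \<le> p" "p \<le> 1"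
  obtain k where k: "d = 2 * k" using assms by (elim evenE)
  have k1: "k \<ge> 1" using assms k by simp
  have "2 / real d = 1 / real k" using k k1 by simp
  moreover have "0 < p"
  proof -
    have "(1 / 4 :: real) powr (2 / real d) \<le> 1" using assms by (intro powr_le1) auto
    then show ?thesis using p by linarith
  qed
  ultimately show "theta_site d p \<noteq> 0"
    using theta_site_pos[of p "2 / 3" d] survival_even[of k p] p k k1 by (metis less_imp_le order.strict_iff_not zero_less_divide_iff zero_less_numeral)
qed

text \<open>A first moment bound: each step multiplies the expected number of wet vertices by at
  most \<open>real d * p\<close>.\<close>

lemma survival_lattice_le:
  assumes "0 \<le> p" "p \<le> 1" "finite A"
  shows "survival (lattice_nbh d) p m A \<le> (real d * p) ^ m * real (card A)"
  using assms(3)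
proof (induction m arbitrary: A)
  case 0
  then show ?case by (auto simp: Suc_le_eq card_gt_0_iff)
next
  case (Suc m)
  have fin: "finite (lattice_nbh d A)" using Suc.prems growth_mapD(2)[OF growth_map_lattice_nbh] by auto
  have "card (lattice_nbh d A) \<le> (\<Sum>k<d. card (inc k ` A))"
    unfolding lattice_nbh_def by (intro card_UN_le) auto
  also have "\<dots> \<le> (\<Sum>k<d. card A)" using Suc.prems by (intro sum_mono card_image_le)
  finally have card: "real (card (lattice_nbh d A)) \<le> real d * real (card A)"
    by (simp flip: of_nat_mult)
  have "site_exp p (lattice_nbh d A) (survival (lattice_nbh d) p m) \<le>
      site_exp p (lattice_nbh d A) (\<lambda>T. (real d * p) ^ m * real (card T))"
    using fin assms finite_subset by (intro site_exp_mono Suc.IH) blast+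
  also have "\<dots> = (real d * p) ^ m * p * real (card (lattice_nbh d A))"
    using fin by (simp add: site_exp_cmult site_exp_card)
  also have "\<dots> \<le> (real d * p) ^ m * p * (real d * real (card A))"
    using card assms by (intro mult_left_mono) auto
  finally show ?case by (simp add: mult_ac)
qed

text \<open>\<open>Sol\<close> has a meaning only for a positive first argument. At
  \<open>1 / (2 * real d)\<close> the first moment bound halves in every step.\<close>

lemma pc_site_pos:
  assumes "d \<ge> 1"
  shows "0 < pc_site d"
proof -
  define p where "p = 1 / (2 * real d)"
  have p: "0 < p" "p \<le> 1" "real d * p = 1 / 2" using assms by (auto simp: p_def field_simps)
  have "(\<lambda>m. p * (1 / 2) ^ m) \<longlonglongrightarrow> p * 0"
    by (intro tendsto_mult tendsto_const LIMSEQ_power_zero) auto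
  moreover have "theta_site d p \<le> p * (1 / 2) ^ m" for m
  proof -
    have "survival (lattice_nbh d) p m {origin} \<le> (1 / 2) ^ m"
      using survival_lattice_le[of p "{origin}" d m] p by (simp add: p(3))
    then have "p * survival (lattice_nbh d) p m {origin} \<le> p * (1 / 2) ^ m"
      using p by (intro mult_left_mono) auto
    then show ?thesis using theta_site_limit(2)[of p d m] p by linarith
  qed
  ultimately have "theta_site d p \<le> p * 0"
    by (intro LIMSEQ_le_const) auto
  then have "theta_site d p = 0" using theta_site_nonneg[of d p] by simp
  then show ?thesis using le_pc_site[of p d] p by simp
qed

section \<open>Searching along columns\<close>

text \<open>\<open>i\<close> counts the sites climbed above the wet site \<open>(y, h)\<close>,
  which is not read again; hence the range from 1.\<close>

definition reached :: "nat \<Rightarrow> 'y \<Rightarrow> nat \<Rightarrow> 'y set \<Rightarrow> ('y \<times> nat) set \<Rightarrow> 'y set" where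
  "reached J y h I T = {z \<in> I. \<exists>i<J. (z, h + i) \<in> T \<and> (\<forall>j\<in>{1..i}. (y, h + j) \<in> T)}"

lemma reached_0 [simp]: "reached 0 y h I T = {}"
  by (simp add: reached_def)

lemma reached_subset: "reached J y h I T \<subseteq> I"
  by (auto simp: reached_def)

lemma reached_Suc:
  "reached (Suc J) y h I T =
     {z \<in> I. (z, h) \<in> T} \<union> (if (y, h + 1) \<in> T then reached J y (h + 1) I T else {})"
proof -
  have col: "(\<forall>j\<in>{1..Suc i}. (y, h + j) \<in> T) \<longleftrightarrow> (y, h + 1) \<in> T \<and> (\<forall>j\<in>{1..i}. (y, h + 1 + j) \<in> T)" for i
  proof -
    have 1: "{1..Suc i} = insert 1 (Suc ` {1..i})"
      by (auto simp: image_Suc_atLeastAtMost)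
    have 2: "(\<forall>j\<in>insert a (Suc ` A). P j) \<longleftrightarrow> P a \<and> (\<forall>j\<in>A. P (Suc j))" for a A P by auto
    show ?thesis unfolding 1 2 by simp
  qed
  have "(\<exists>i<Suc J. (z, h + i) \<in> T \<and> (\<forall>j\<in>{1..i}. (y, h + j) \<in> T)) \<longleftrightarrow>
     (z, h) \<in> T \<or> ((y, h + 1) \<in> T \<and> (\<exists>i<J. (z, h + 1 + i) \<in> T \<and> (\<forall>j\<in>{1..i}. (y, h + 1 + j) \<in> T)))" for z
    unfolding Ex_less_Suc2 col by auto
  then show ?thesis by (auto simp: reached_def)
qed

text \<open>The success of one child searched at \<open>J\<close> heights with split columns: it is
  open at once, or its part of the next column site is open, with probability \<open>r\<close>, and
  a search of smaller depth succeeds from there.\<close>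

primrec column_prob :: "real \<Rightarrow> real \<Rightarrow> nat \<Rightarrow> real" where
  "column_prob p r 0 = 0"
| "column_prob p r (Suc J) = 1 - (1 - p) * (1 - column_prob p r J * r)"

lemma column_prob_bounds:
  assumes "0 \<le> p" "p \<le> 1" "0 \<le> r" "r \<le> 1"
  shows "0 \<le> column_prob p r J \<and> column_prob p r J \<le> 1"
proof (induction J)
  case (Suc J)
  have "0 \<le> column_prob p r J * r" "column_prob p r J * r \<le> 1"
    using Suc assms mult_le_one by auto
  then have "0 \<le> (1 - p) * (1 - column_prob p r J * r)" "(1 - p) * (1 - column_prob p r J * r) \<le> 1"
    using assms by (auto intro!: mult_le_one)
  then show ?case by simp
qed simp

text \<open>A closed column site stops all children at once, whereas independent coins with success probability \<open>r\<close>
  for each child all fail with probability \<open>(1 - r) ^ card I \<ge> 1 - p\<close>.\<close>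
lemma site_exp_column_step:
  assumes p: "0 \<le> p" "p \<le> 1" and r: "0 \<le> r" "r \<le> 1" and a: "0 \<le> a" "a \<le> 1"
    and I: "finite I" "1 - p \<le> (1 - r) ^ card I" and g: "finite_mono g"
  shows "site_exp (1 - (1 - p) * (1 - a * r)) I g \<le>
    site_exp p I (\<lambda>A. p * site_exp a I (\<lambda>B. g (A \<union> B)) + (1 - p) * g A)"
proof -
  have "site_exp (1 - (1 - p) * (1 - a * r)) I g =
     site_exp p I (\<lambda>A. site_exp a I (\<lambda>B. site_exp r I (\<lambda>Q. g (A \<union> B \<inter> Q))))"
    unfolding site_exp_Un_thin[OF I(1), symmetric]
    by (subst site_exp_Int_thin[OF I(1), symmetric]) simp
  also have "\<dots> \<le> site_exp p I (\<lambda>A. site_exp a I (\<lambda>B. p * g (A \<union> B) + (1 - p) * g A))"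
  proof (intro site_exp_mono p a)
    fix A B assume AB: "A \<subseteq> I" "B \<subseteq> I"
    then have fin: "finite A" "finite B" using I finite_subset by auto
    have "site_exp r I (\<lambda>Q. g (A \<union> B \<inter> Q)) \<le> site_exp r I (\<lambda>Q. if Q = {} then g A else g (A \<union> B))"
      using fin by (intro site_exp_mono r) (auto intro!: finite_monoD[OF g])
    also have "\<dots> = (1 - r) ^ card I * g A + (1 - (1 - r) ^ card I) * g (A \<union> B)"
      by (rule site_exp_empty_prob[OF I(1)])
    also have "\<dots> \<le> p * g (A \<union> B) + (1 - p) * g A"
    proof -
      have "g A \<le> g (A \<union> B)" using fin by (intro finite_monoD[OF g]) auto
      then have "0 \<le> ((1 - r) ^ card I - (1 - p)) * (g (A \<union> B) - g A)"
        using I(2) by (intro mult_nonneg_nonneg) auto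
      then show ?thesis by (simp add: algebra_simps)
    qed
    finally show "site_exp r I (\<lambda>Q. g (A \<union> B \<inter> Q)) \<le> p * g (A \<union> B) + (1 - p) * g A" .
  qed
  also have "\<dots> = site_exp p I (\<lambda>A. p * site_exp a I (\<lambda>B. g (A \<union> B)) + (1 - p) * g A)"
    using I by (simp add: site_exp_add site_exp_cmult site_exp_const)
  finally show ?thesis .
qed

lemma site_exp_single:
  assumes "finite S" "x \<in> S"
  shows "site_exp p S (\<lambda>T. if x \<in> T then a else b) = p * a + (1 - p) * b"
proof -
  obtain R where R: "S = insert x R" "x \<notin> R" by (meson assms(2) mk_disjoint_insert)
  have "site_exp p R (\<lambda>T. if x \<in> T then a else b) = site_exp p R (\<lambda>T. b)"
    using R by (intro site_exp_cong) auto
  then show ?thesis using R assms by (simp add: site_exp_insert site_exp_const)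
qed

lemma site_exp_row:
  assumes "finite S" "I \<times> {h} \<subseteq> S"
  shows "site_exp p S (\<lambda>T. g {z \<in> I. (z, h) \<in> T}) = site_exp p I g"
proof -
  have "site_exp p S (\<lambda>T. g {z \<in> I. (z, h) \<in> T}) = site_exp p (S \<inter> I \<times> {h}) (\<lambda>T. g {z \<in> I. (z, h) \<in> T})"
    using assms(1) by (intro site_exp_depends arg_cong[of _ _ g]) auto
  also have "S \<inter> I \<times> {h} = (\<lambda>z. (z, h)) ` I" using assms(2) by auto
  also have "site_exp p \<dots> (\<lambda>T. g {z \<in> I. (z, h) \<in> T}) = site_exp p I (\<lambda>T. g {z \<in> I. (z, h) \<in> (\<lambda>z. (z, h)) ` T})"
  proof (rule site_exp_image)
    have "finite ((\<lambda>z. (z, h)) ` I)" using assms by (auto intro: finite_subset)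
    then show "finite I" by (rule finite_imageD) (auto simp: inj_on_def)
  qed (auto simp: inj_on_def)
  also have "\<dots> = site_exp p I g"
    by (intro site_exp_cong arg_cong[of _ _ g]) auto
  finally show ?thesis .
qed

text \<open>Induction on the depth: the row of children at height \<open>h\<close>, the column site
  \<open>(y, h + 1)\<close> and all that is read higher up are disjoint, hence independent.\<close>

lemma site_exp_reached:
  assumes p: "0 \<le> p" "p \<le> 1" and r: "0 \<le> r" "r \<le> 1"
    and I: "finite I" "y \<notin> I" "1 - p \<le> (1 - r) ^ card I" and S: "finite S"
    and "I \<times> {h..<h + J} \<subseteq> S" "{y} \<times> {h + 1..h + J} \<subseteq> S" and g: "finite_mono g"
  shows "site_exp (column_prob p r J) I g \<le> site_exp p S (\<lambda>T. g (reached J y h I T))"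
  using assms(9-11)
proof (induction J arbitrary: h g)
  case 0
  have "site_exp 0 S' g = g {}" if "finite S'" for S' :: "'a set"
    using that by (induction S' rule: finite_induct) (auto simp: site_exp_insert)
  then show ?case using I S by (simp add: site_exp_const)
next
  case (Suc J)
  note a = column_prob_bounds[OF p r, of J]
  let ?R = "\<lambda>T. reached J y (h + 1) I T" and ?A = "\<lambda>T. {z \<in> I. (z, h) \<in> T}"
  have g': "finite_mono (\<lambda>B. g (A \<union> B))" if "finite A" for A
    unfolding finite_mono_def using that by (auto intro!: finite_monoD[OF Suc.prems(3)])
  have Rdep: "?R T = ?R (T \<inter> (I \<times> {h + 1..} \<union> {y} \<times> {h + 2..}))" for T
    unfolding reached_def by (intro Collect_cong conj_cong refl ex_cong1 ball_cong) auto
  have "site_exp (column_prob p r (Suc J)) I g \<le>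
      site_exp p I (\<lambda>A. p * site_exp (column_prob p r J) I (\<lambda>B. g (A \<union> B)) + (1 - p) * g A)"
    unfolding column_prob.simps using a by (intro site_exp_column_step p r I Suc.prems(3)) auto
  also have "\<dots> \<le> site_exp p I (\<lambda>A. p * site_exp p S (\<lambda>V. g (A \<union> ?R V)) + (1 - p) * g A)"
  proof (intro site_exp_mono p add_right_mono mult_left_mono)
    fix A assume "A \<subseteq> I"
    then have "finite A" using I finite_subset by auto
    moreover have "I \<times> {h + 1..<h + 1 + J} \<subseteq> S" "{y} \<times> {h + 1 + 1..h + 1 + J} \<subseteq> S"
      using Suc.prems(1,2) by fastforce+
    ultimately show "site_exp (column_prob p r J) I (\<lambda>B. g (A \<union> B)) \<le> site_exp p S (\<lambda>V. g (A \<union> ?R V))"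
      using Suc.IH[of "h + 1" "\<lambda>B. g (A \<union> B)"] g' by blast
  qed
  also have "\<dots> = site_exp p S (\<lambda>T. p * site_exp p S (\<lambda>V. g (?A T \<union> ?R V)) + (1 - p) * g (?A T))"
    using Suc.prems(1) S by (intro site_exp_row[symmetric]) auto
  \<comment> \<open>\<open>T\<close> serves the row at height \<open>h\<close>, \<open>U\<close> the
    column site and \<open>V\<close> everything above; the following steps merge the copies again,
    the highest ones first.\<close>
  also have "\<dots> = site_exp p S (\<lambda>T. site_exp p S (\<lambda>U. site_exp p S (\<lambda>V.
      g (?A T \<union> (if (y, h + 1) \<in> U then ?R V else {})))))"
  proof (intro site_exp_cong)
    fix T
    have "site_exp p S (\<lambda>U. site_exp p S (\<lambda>V. g (?A T \<union> (if (y, h + 1) \<in> U then ?R V else {})))) =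
      site_exp p S (\<lambda>U. if (y, h + 1) \<in> U then site_exp p S (\<lambda>V. g (?A T \<union> ?R V)) else g (?A T))"
      using S by (intro site_exp_cong) (simp add: site_exp_const)
    also have "\<dots> = p * site_exp p S (\<lambda>V. g (?A T \<union> ?R V)) + (1 - p) * g (?A T)"
      using Suc.prems(2) by (intro site_exp_single S) auto
    finally show "p * site_exp p S (\<lambda>V. g (?A T \<union> ?R V)) + (1 - p) * g (?A T) =
      site_exp p S (\<lambda>U. site_exp p S (\<lambda>V. g (?A T \<union> (if (y, h + 1) \<in> U then ?R V else {}))))" by simp
  qed
  also have "\<dots> = site_exp p S (\<lambda>T. site_exp p S (\<lambda>U.
      g (?A T \<union> (if (y, h + 1) \<in> U then ?R U else {}))))"
  proof (rule site_exp_cong)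
    fix T
    show "site_exp p S (\<lambda>U. site_exp p S (\<lambda>V. g (?A T \<union> (if (y, h + 1) \<in> U then ?R V else {})))) =
      site_exp p S (\<lambda>U. g (?A T \<union> (if (y, h + 1) \<in> U then ?R U else {})))"
    proof (rule site_exp_indep[OF S, symmetric, where D = "{(y, h + 1)}"
          and E = "I \<times> {h + 1..} \<union> {y} \<times> {h + 2..}"])
      fix U V
      show "g (?A T \<union> (if (y, h + 1) \<in> U then ?R V else {})) =
        g (?A T \<union> (if (y, h + 1) \<in> U \<inter> {(y, h + 1)}
           then ?R (V \<inter> (I \<times> {h + 1..} \<union> {y} \<times> {h + 2..})) else {}))"
        using Rdep[of V] by auto
    qed (use I in auto)
  qed
  also have "\<dots> = site_exp p S (\<lambda>T. g (?A T \<union> (if (y, h + 1) \<in> T then ?R T else {})))"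
  proof (rule site_exp_indep[OF S, symmetric, where D = "I \<times> {h}"
        and E = "I \<times> {h + 1..} \<union> {y} \<times> {h + 1..}"])
    fix T U
    have "?A T = ?A (T \<inter> I \<times> {h})" by auto
    moreover have "?R U = ?R (U \<inter> (I \<times> {h + 1..} \<union> {y} \<times> {h + 1..}))"
      unfolding reached_def by (intro Collect_cong conj_cong refl ex_cong1 ball_cong) auto
    ultimately show "g (?A T \<union> (if (y, h + 1) \<in> U then ?R U else {})) =
      g (?A (T \<inter> I \<times> {h}) \<union> (if (y, h + 1) \<in> U \<inter> (I \<times> {h + 1..} \<union> {y} \<times> {h + 1..})
         then ?R (U \<inter> (I \<times> {h + 1..} \<union> {y} \<times> {h + 1..})) else {}))"
      by auto
  qed (use I in auto)
  finally show ?case by (simp add: reached_Suc)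
qed

text \<open>Each parent reads its own column and those of its assigned children. These columns are
  disjoint for different parents, so parents can be added one at a time.\<close>

lemma site_exp_reached_family:
  fixes I :: "('y \<times> nat) \<Rightarrow> 'y set"
  assumes p: "0 \<le> p" "p \<le> 1" and r: "0 \<le> r" "r \<le> 1" and S: "finite S"
    and "finite X" "inj_on fst X" "disjoint_family_on I X"
    and "\<And>x x'. x \<in> X \<Longrightarrow> x' \<in> X \<Longrightarrow> fst x \<notin> I x'"
    and "\<And>x. x \<in> X \<Longrightarrow> finite (I x) \<and> 1 - p \<le> (1 - r) ^ card (I x)"
    and "\<And>x. x \<in> X \<Longrightarrow> I x \<times> {snd x..<snd x + J} \<subseteq> S \<and> {fst x} \<times> {snd x + 1..snd x + J} \<subseteq> S"
    and "finite_mono g"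
  shows "site_exp (column_prob p r J) (\<Union>x\<in>X. I x) g \<le>
    site_exp p S (\<lambda>T. g (\<Union>x\<in>X. reached J (fst x) (snd x) (I x) T))"
  using assms(6-12)
proof (induction X arbitrary: g rule: finite_induct)
  case empty
  then show ?case using S by (simp add: site_exp_const)
next
  case (insert x X)
  note prems = insert.prems
  note a = column_prob_bounds[OF p r, of J]
  let ?R = "\<lambda>x T. reached J (fst x) (snd x) (I x) T"
  let ?U = "\<Union>x\<in>X. I x"
  have disj: "I x' \<inter> I x = {}" if "x' \<in> X" for x'
    using prems(2) insert.hyps that by (auto simp: disjoint_family_on_def)
  have fst: "fst x' \<noteq> fst x" if "x' \<in> X" for x'
    using prems(1) insert.hyps that by (auto simp: inj_on_def)
  have fin: "finite ?U" "finite (I x)" using insert.hyps prems(4) by auto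
  define g' where "g' B = site_exp (column_prob p r J) (I x) (\<lambda>C. g (B \<union> C))" for B
  have g'': "finite_mono (\<lambda>C. g (B \<union> C))" if "finite B" for B
    unfolding finite_mono_def using that by (auto intro!: finite_monoD[OF prems(6)])
  have g': "finite_mono g'"
    unfolding finite_mono_def g'_def
  proof (intro allI impI site_exp_mono)
    fix A B C :: "'y set" assume "A \<subseteq> B" "finite B" "C \<subseteq> I x"
    then show "g (A \<union> C) \<le> g (B \<union> C)"
      using fin finite_subset by (intro finite_monoD[OF prems(6)]) auto
  qed (use a in auto)
  have "site_exp (column_prob p r J) (\<Union>x\<in>insert x X. I x) g = site_exp (column_prob p r J) (?U \<union> I x) g"
    by (simp add: Un_commute)
  also have "\<dots> = site_exp (column_prob p r J) ?U g'"
    unfolding g'_def using fin disj by (intro site_exp_union) auto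
  also have "\<dots> \<le> site_exp p S (\<lambda>T. g' (\<Union>x\<in>X. ?R x T))"
    using prems g' by (intro insert.IH) (auto simp: disjoint_family_on_def)
  also have "\<dots> \<le> site_exp p S (\<lambda>T. site_exp p S (\<lambda>U. g ((\<Union>x\<in>X. ?R x T) \<union> ?R x U)))"
  proof (intro site_exp_mono p)
    fix T
    have "(\<Union>x\<in>X. ?R x T) \<subseteq> ?U" using reached_subset by fast
    then have "finite (\<Union>x\<in>X. ?R x T)" using fin finite_subset by blast
    then show "g' (\<Union>x\<in>X. ?R x T) \<le> site_exp p S (\<lambda>U. g ((\<Union>x\<in>X. ?R x T) \<union> ?R x U))"
      unfolding g'_def using prems(3-5) S by (intro site_exp_reached p r g'') auto
  qed
  also have "\<dots> = site_exp p S (\<lambda>T. g ((\<Union>x\<in>X. ?R x T) \<union> ?R x T))"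
  proof (rule site_exp_indep[OF S, symmetric])
    let ?D = "(\<Union>x\<in>X. (I x \<union> {fst x}) \<times> UNIV)" and ?E = "(I x \<union> {fst x}) \<times> UNIV"
    fix T U :: "('y \<times> nat) set"
    have "(z, n) \<in> T \<longleftrightarrow> (z, n) \<in> T \<inter> ?D" if "x' \<in> X" "z \<in> I x' \<or> z = fst x'" for x' z n
      using that by blast
    then have "?R x' T = ?R x' (T \<inter> ?D)" if "x' \<in> X" for x'
      unfolding reached_def using that by (intro Collect_cong conj_cong refl ex_cong1 ball_cong) blast+
    then have "(\<Union>x\<in>X. ?R x T) = (\<Union>x\<in>X. ?R x (T \<inter> ?D))" by simp
    moreover have "?R x U = ?R x (U \<inter> ?E)"
      unfolding reached_def by (intro Collect_cong conj_cong refl ex_cong1 ball_cong) auto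
    ultimately show "g ((\<Union>x\<in>X. ?R x T) \<union> ?R x U) = g ((\<Union>x\<in>X. ?R x (T \<inter> ?D)) \<union> ?R x (U \<inter> ?E))"
      by simp
    show "?D \<inter> ?E = {}"
    proof -
      have "(I x' \<union> {fst x'}) \<inter> (I x \<union> {fst x}) = {}" if "x' \<in> X" for x'
        using disj[OF that] fst[OF that] prems(3)[of x x'] prems(3)[of x' x] that by auto
      then show ?thesis by blast
    qed
  qed
  finally show ?case by (simp add: Un_commute)
qed

section \<open>From dimension d to dimension d + 1\<close>

text \<open>A site \<open>(y, h)\<close> stands for the vertex of \<open>\<int>\<^bsup>d+1\<^esup>\<close> with projection \<open>y\<close> and last coordinate \<open>h\<close>. A state
  contains one wet site over each vertex of a wet set on level \<open>n\<close> of \<open>\<int>\<^bsup>d\<^esup>\<close>. Each child is searched from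
  a single parent, at the first height that the column of the parent allows.\<close>
type_synonym column_state = "int \<times> ((nat \<Rightarrow> int) \<times> nat) set"

definition children :: "nat \<Rightarrow> (nat \<Rightarrow> int) \<Rightarrow> (nat \<Rightarrow> int) set" where
  "children d y = (\<lambda>k. inc k y) ` {..<d}"

lemma lattice_nbh_children: "lattice_nbh d A = (\<Union>y\<in>A. children d y)"
  by (auto simp: lattice_nbh_def children_def)

definition parent :: "nat \<Rightarrow> ((nat \<Rightarrow> int) \<times> nat) set \<Rightarrow> (nat \<Rightarrow> int) \<Rightarrow> (nat \<Rightarrow> int) \<times> nat" where
  "parent d X z = (SOME x. x \<in> X \<and> z \<in> children d (fst x))"

lemma parent:
  assumes "z \<in> lattice_nbh d (fst ` X)"
  shows "parent d X z \<in> X" "z \<in> children d (fst (parent d X z))"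
proof -
  have "\<exists>x. x \<in> X \<and> z \<in> children d (fst x)"
    using assms by (auto simp: lattice_nbh_children)
  then have "parent d X z \<in> X \<and> z \<in> children d (fst (parent d X z))"
    unfolding parent_def by (rule someI_ex)
  then show "parent d X z \<in> X" "z \<in> children d (fst (parent d X z))" by auto
qed

definition column_hit where
  "column_hit d X T z i \<longleftrightarrow> (z, snd (parent d X z) + i) \<in> T \<and>
     (\<forall>j\<in>{1..i}. (fst (parent d X z), snd (parent d X z) + j) \<in> T)"

definition column_first where
  "column_first d X T z i \<longleftrightarrow> column_hit d X T z i \<and> (\<forall>i'<i. \<not> column_hit d X T z i')"

lemma column_first_unique: "column_first d X T z i \<Longrightarrow> column_first d X T z i' \<Longrightarrow> i = i'"
  by (metis column_first_def linorder_neqE_nat)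

lemma column_first_exists:
  assumes "column_hit d X T z i" shows "\<exists>i'\<le>i. column_first d X T z i'"
  using assms exists_least_iff[of "column_hit d X T z"] unfolding column_first_def
  by (metis linorder_le_less_linear)

definition column_step :: "nat \<Rightarrow> nat \<Rightarrow> column_state \<Rightarrow> ((nat \<Rightarrow> int) \<times> nat) set \<Rightarrow> column_state" where
  "column_step d J \<sigma> T = (fst \<sigma> + 1, {(z, snd (parent d (snd \<sigma>) z) + i) | z i.
     z \<in> lattice_nbh d (fst ` snd \<sigma>) \<and> i < J \<and> column_first d (snd \<sigma>) T z i})"

text \<open>Columns of later levels are untouched. On the present level a column is unread exactly
  above its wet site, where the search stopped; columns without a wet site count as spent.\<close>

definition column_fresh :: "nat \<Rightarrow> column_state \<Rightarrow> ((nat \<Rightarrow> int) \<times> nat) set" where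
  "column_fresh d \<sigma> = {x. fst x \<in> Zd d \<and> (fst \<sigma> < level d (fst x) \<or> (\<exists>h<snd x. (fst x, h) \<in> snd \<sigma>))}"

definition column_query :: "nat \<Rightarrow> nat \<Rightarrow> column_state \<Rightarrow> ((nat \<Rightarrow> int) \<times> nat) set" where
  "column_query d J \<sigma> =
     (\<Union>z\<in>lattice_nbh d (fst ` snd \<sigma>). {z} \<times> {snd (parent d (snd \<sigma>) z)..<snd (parent d (snd \<sigma>) z) + J}) \<union>
     (\<Union>x\<in>snd \<sigma>. {fst x} \<times> {snd x + 1..snd x + J})"

definition column_inv :: "nat \<Rightarrow> column_state \<Rightarrow> bool" where
  "column_inv d \<sigma> \<longleftrightarrow> finite (snd \<sigma>) \<and> inj_on fst (snd \<sigma>) \<and>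
     (\<forall>x\<in>snd \<sigma>. fst x \<in> Zd d \<and> level d (fst x) = fst \<sigma>)"

lemma column_hit_cong:
  assumes "T \<inter> Q = U \<inter> Q" "(z, snd (parent d X z) + i) \<in> Q"
    "\<And>j. 1 \<le> j \<Longrightarrow> j \<le> i \<Longrightarrow> (fst (parent d X z), snd (parent d X z) + j) \<in> Q"
  shows "column_hit d X T z i \<longleftrightarrow> column_hit d X U z i"
proof -
  have "x \<in> T \<longleftrightarrow> x \<in> U" if "x \<in> Q" for x using assms(1) that by blast
  then show ?thesis using assms(2,3) unfolding column_hit_def by (metis atLeastAtMost_iff)
qed

lemma column_query_hit:
  assumes "z \<in> lattice_nbh d (fst ` snd \<sigma>)" "i < J"
  shows "(z, snd (parent d (snd \<sigma>) z) + i) \<in> column_query d J \<sigma>"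
    and "1 \<le> j \<Longrightarrow> j \<le> i \<Longrightarrow> (fst (parent d (snd \<sigma>) z), snd (parent d (snd \<sigma>) z) + j) \<in> column_query d J \<sigma>"
  using assms parent[OF assms(1)] unfolding column_query_def by fastforce+

lemma column_step_eqI:
  assumes "\<And>z i. z \<in> lattice_nbh d (fst ` snd \<sigma>) \<Longrightarrow> i < J \<Longrightarrow>
    column_first d (snd \<sigma>) U z i \<longleftrightarrow> column_first d (snd \<sigma>) T z i"
  shows "column_step d J \<sigma> U = column_step d J \<sigma> T"
  using assms unfolding column_step_def by blast

lemma column_nbh_level:
  assumes "column_inv d \<sigma>" "z \<in> lattice_nbh d (fst ` snd \<sigma>)"
  shows "level d z = fst \<sigma> + 1" "z \<in> Zd d"
proof -
  show "level d z = fst \<sigma> + 1"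
    using assms by (intro lattice_nbh_level[of "fst ` snd \<sigma>"]) (auto simp: column_inv_def)
  show "z \<in> Zd d"
    using assms lattice_nbh_Zd[of "fst ` snd \<sigma>" d] by (auto simp: column_inv_def)
qed

lemma column_finite_query:
  assumes "column_inv d \<sigma>"
  shows "finite (column_query d J \<sigma>)"
  using assms growth_mapD(2)[OF growth_map_lattice_nbh, of "fst ` snd \<sigma>" d]
  by (auto simp: column_query_def column_inv_def)

lemma column_step_query:
  "column_step d J \<sigma> (T \<inter> column_query d J \<sigma>) = column_step d J \<sigma> T"
proof (rule column_step_eqI)
  fix z i assume z: "z \<in> lattice_nbh d (fst ` snd \<sigma>)" "i < J"
  have "column_hit d (snd \<sigma>) (T \<inter> column_query d J \<sigma>) z i' \<longleftrightarrow> column_hit d (snd \<sigma>) T z i'" if "i' \<le> i" for i'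
    using column_query_hit[OF z(1), of i' J] that z(2)
    by (intro column_hit_cong[of _ "column_query d J \<sigma>"]) auto
  then show "column_first d (snd \<sigma>) (T \<inter> column_query d J \<sigma>) z i \<longleftrightarrow> column_first d (snd \<sigma>) T z i"
    by (auto simp: column_first_def)
qed

lemma column_step_mem:
  "(z, h) \<in> snd (column_step d J \<sigma> T) \<longleftrightarrow> z \<in> lattice_nbh d (fst ` snd \<sigma>) \<and>
    (\<exists>i<J. h = snd (parent d (snd \<sigma>) z) + i \<and> column_first d (snd \<sigma>) T z i)"
  by (auto simp: column_step_def)

lemma fst_column_step [simp]: "fst (column_step d J \<sigma> T) = fst \<sigma> + 1"
  by (simp add: column_step_def)

lemma column_inv_step:
  assumes "column_inv d \<sigma>"
  shows "column_inv d (column_step d J \<sigma> T)"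
proof -
  have "snd (column_step d J \<sigma> T) \<subseteq> column_query d J \<sigma>"
    using column_query_hit(1)[of _ d \<sigma> _ J] by (auto simp: column_step_def)
  then have "finite (snd (column_step d J \<sigma> T))"
    using column_finite_query[OF assms] finite_subset by blast
  moreover have "inj_on fst (snd (column_step d J \<sigma> T))"
    by (rule inj_onI) (auto simp: column_step_mem dest: column_first_unique)
  moreover have "fst x \<in> Zd d \<and> level d (fst x) = fst \<sigma> + 1" if "x \<in> snd (column_step d J \<sigma> T)" for x
    using that column_nbh_level[OF assms] by (cases x) (auto simp: column_step_mem)
  ultimately show ?thesis by (simp add: column_inv_def)
qed

lemma column_query_fresh:
  assumes "column_inv d \<sigma>"
  shows "column_query d J \<sigma> \<subseteq> column_fresh d \<sigma>"
  unfolding column_query_def column_fresh_def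
proof (intro Un_least UN_least subsetI CollectI)
  fix z x assume "z \<in> lattice_nbh d (fst ` snd \<sigma>)"
    "x \<in> {z} \<times> {snd (parent d (snd \<sigma>) z)..<snd (parent d (snd \<sigma>) z) + J}"
  then show "fst x \<in> Zd d \<and> (fst \<sigma> < level d (fst x) \<or> (\<exists>h<snd x. (fst x, h) \<in> snd \<sigma>))"
    using column_nbh_level[OF assms, of z] by auto
next
  fix y x assume y: "y \<in> snd \<sigma>" "x \<in> {fst y} \<times> {snd y + 1..snd y + J}"
  then have "fst x \<in> Zd d" "snd y < snd x" "(fst x, snd y) \<in> snd \<sigma>"
    using assms by (auto simp: column_inv_def)
  then show "fst x \<in> Zd d \<and> (fst \<sigma> < level d (fst x) \<or> (\<exists>h<snd x. (fst x, h) \<in> snd \<sigma>))" by blast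
qed

lemma column_fresh_step:
  assumes "column_inv d \<sigma>"
  shows "column_fresh d (column_step d J \<sigma> T) \<subseteq> column_fresh d \<sigma>"
proof
  fix x assume x: "x \<in> column_fresh d (column_step d J \<sigma> T)"
  then have "fst \<sigma> < level d (fst x)"
    using column_nbh_level(1)[OF assms, of "fst x"]
    by (auto simp: column_fresh_def column_step_mem)
  then show "x \<in> column_fresh d \<sigma>" using x by (auto simp: column_fresh_def)
qed

text \<open>Sites above the first success of a child are queried but stay fresh. Agreement up to the
  first success already puts the success of the other configuration at the same height; if there is
  none, the whole range is spent and agrees.\<close>

lemma column_step_determined:
  assumes inv: "column_inv d \<sigma>"
    and agree: "T \<inter> (column_query d J \<sigma> - column_fresh d (column_step d J \<sigma> T)) =
      U \<inter> (column_query d J \<sigma> - column_fresh d (column_step d J \<sigma> T))"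
  shows "column_step d J \<sigma> U = column_step d J \<sigma> T"
proof (rule column_step_eqI)
  let ?Y = "column_step d J \<sigma> T"
  let ?Q = "column_query d J \<sigma> - column_fresh d ?Y"
  fix z i assume z: "z \<in> lattice_nbh d (fst ` snd \<sigma>)" and i: "i < J"
  have hit: "column_hit d (snd \<sigma>) T z i' \<longleftrightarrow> column_hit d (snd \<sigma>) U z i'"
    if i': "i' < J" "\<And>i0. i0 < J \<Longrightarrow> column_first d (snd \<sigma>) T z i0 \<Longrightarrow> i' \<le> i0" for i'
  proof (rule column_hit_cong[OF agree])
    have "(z, snd (parent d (snd \<sigma>) z) + i') \<notin> column_fresh d ?Y"
    proof
      assume "(z, snd (parent d (snd \<sigma>) z) + i') \<in> column_fresh d ?Y"
      then obtain h where h: "h < snd (parent d (snd \<sigma>) z) + i'" "(z, h) \<in> snd ?Y"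
        using column_nbh_level(1)[OF inv z] by (auto simp: column_fresh_def)
      then obtain i0 where "i0 < J" "h = snd (parent d (snd \<sigma>) z) + i0" "column_first d (snd \<sigma>) T z i0"
        by (auto simp: column_step_mem)
      then show False using i'(2)[of i0] h by simp
    qed
    then show "(z, snd (parent d (snd \<sigma>) z) + i') \<in> ?Q"
      using column_query_hit(1)[OF z i'(1)] by blast
    fix j assume j: "1 \<le> j" "j \<le> i'"
    \<comment> \<open>The parent lies one level below the new state, so nothing in its column is
      fresh any more.\<close>
    have lev: "level d (fst (parent d (snd \<sigma>) z)) = fst \<sigma>"
      using inv parent(1)[OF z] by (auto simp: column_inv_def)
    then have "(fst (parent d (snd \<sigma>) z), h) \<notin> snd ?Y" for h
      using column_nbh_level(1)[OF inv, of "fst (parent d (snd \<sigma>) z)"] by (auto simp: column_step_mem)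
    then have "(fst (parent d (snd \<sigma>) z), snd (parent d (snd \<sigma>) z) + j) \<notin> column_fresh d ?Y"
      using lev by (auto simp: column_fresh_def)
    then show "(fst (parent d (snd \<sigma>) z), snd (parent d (snd \<sigma>) z) + j) \<in> ?Q"
      using column_query_hit(2)[OF z i'(1) j] by blast
  qed
  show "column_first d (snd \<sigma>) U z i \<longleftrightarrow> column_first d (snd \<sigma>) T z i"
  proof (cases "\<exists>i0<J. column_first d (snd \<sigma>) T z i0")
    case True
    then obtain i0 where i0: "i0 < J" "column_first d (snd \<sigma>) T z i0" by blast
    have "column_hit d (snd \<sigma>) T z i' \<longleftrightarrow> column_hit d (snd \<sigma>) U z i'" if "i' \<le> i0" for i'
      using hit[of i'] that i0 column_first_unique by (metis le_less_trans)
    then have "column_first d (snd \<sigma>) U z i0" using i0(2) by (auto simp: column_first_def)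
    then show ?thesis using i0 column_first_unique by metis
  next
    case False
    then have eq: "column_hit d (snd \<sigma>) T z i' \<longleftrightarrow> column_hit d (snd \<sigma>) U z i'" if "i' < J" for i'
      using hit[of i'] that by blast
    show ?thesis unfolding column_first_def using eq i by (meson less_trans)
  qed
qed

interpretation column: exploration "column_step d J" "column_fresh d" "column_query d J" "column_inv d" for d J
  by unfold_locales
    (rule column_finite_query column_step_query column_inv_step column_query_fresh column_fresh_step
      column_step_determined; assumption)+

lemma fst_column_step_reached:
  "fst ` snd (column_step d J \<sigma> T) = (\<Union>x\<in>snd \<sigma>. reached J (fst x) (snd x)
     {z \<in> lattice_nbh d (fst ` snd \<sigma>). parent d (snd \<sigma>) z = x} T)"
  (is "?L = ?R")
proof (intro equalityI subsetI)
  fix z assume "z \<in> ?L"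
  then obtain h where "(z, h) \<in> snd (column_step d J \<sigma> T)" by auto
  then obtain i where z: "z \<in> lattice_nbh d (fst ` snd \<sigma>)" "i < J" "column_first d (snd \<sigma>) T z i"
    by (auto simp: column_step_mem)
  then show "z \<in> ?R"
    using parent(1)[OF z(1)] by (intro UN_I[of "parent d (snd \<sigma>) z"]) (auto simp: reached_def column_first_def column_hit_def)
next
  fix z assume "z \<in> ?R"
  then obtain i where z: "z \<in> lattice_nbh d (fst ` snd \<sigma>)" "i < J" "column_hit d (snd \<sigma>) T z i"
    by (auto simp: reached_def column_hit_def)
  then obtain i' where "i' < J" "column_first d (snd \<sigma>) T z i'"
    using column_first_exists by (metis le_less_trans)
  then have "(z, snd (parent d (snd \<sigma>) z) + i') \<in> snd (column_step d J \<sigma> T)"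
    using z by (auto simp: column_step_mem)
  then show "z \<in> ?L" by force
qed

text \<open>A parent is assigned at most \<open>d\<close> children, so the condition on
  \<open>r\<close> for \<open>d\<close> coins covers every group.\<close>

lemma column_survival_step:
  assumes p: "0 \<le> p" "p \<le> 1" and r: "0 \<le> r" "r \<le> 1" "1 - p \<le> (1 - r) ^ d"
    and \<sigma>: "column_inv d \<sigma>" and S: "finite S" "column_query d J \<sigma> \<subseteq> S" and g: "finite_mono g"
  shows "site_exp (column_prob p r J) (lattice_nbh d (fst ` snd \<sigma>)) g \<le>
    site_exp p S (\<lambda>T. g (fst ` snd (column_step d J \<sigma> T)))"
proof -
  let ?N = "lattice_nbh d (fst ` snd \<sigma>)"
  let ?I = "\<lambda>x. {z \<in> ?N. parent d (snd \<sigma>) z = x}"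
  have fin: "finite ?N"
    using \<sigma> growth_mapD(2)[OF growth_map_lattice_nbh] by (auto simp: column_inv_def)
  have N: "?N = (\<Union>x\<in>snd \<sigma>. ?I x)" using parent(1)[of _ d "snd \<sigma>"] by auto
  have card: "finite (?I x) \<and> 1 - p \<le> (1 - r) ^ card (?I x)" for x
  proof
    show fx: "finite (?I x)" using fin by auto
    have "?I x \<subseteq> children d (fst x)" using parent(2)[of _ d "snd \<sigma>"] by auto
    then have "card (?I x) \<le> card (children d (fst x))" by (intro card_mono) (auto simp: children_def)
    also have "\<dots> \<le> d" unfolding children_def using card_image_le[of "{..<d}"] by simp
    finally have "(1 - r) ^ d \<le> (1 - r) ^ card (?I x)" using r by (intro power_decreasing) auto
    then show "1 - p \<le> (1 - r) ^ card (?I x)" using r by simp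
  qed
  have "site_exp (column_prob p r J) (\<Union>x\<in>snd \<sigma>. ?I x) g \<le>
      site_exp p S (\<lambda>T. g (\<Union>x\<in>snd \<sigma>. reached J (fst x) (snd x) (?I x) T))"
  proof (intro site_exp_reached_family p r(1,2) S(1) g)
    show "finite (snd \<sigma>)" "inj_on fst (snd \<sigma>)" using \<sigma> by (auto simp: column_inv_def)
    show "disjoint_family_on ?I (snd \<sigma>)" by (auto simp: disjoint_family_on_def)
    fix x x' assume x: "x \<in> snd \<sigma>" "x' \<in> snd \<sigma>"
    have "level d (fst x) = fst \<sigma>" using \<sigma> x by (auto simp: column_inv_def)
    then show "fst x \<notin> ?I x'" using column_nbh_level(1)[OF \<sigma>, of "fst x"] by auto
  next
    fix x assume x: "x \<in> snd \<sigma>"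
    show "finite (?I x) \<and> 1 - p \<le> (1 - r) ^ card (?I x)" by (rule card)
    have "?I x \<times> {snd x..<snd x + J} \<subseteq> column_query d J \<sigma>"
      unfolding column_query_def by auto
    moreover have "{fst x} \<times> {snd x + 1..snd x + J} \<subseteq> column_query d J \<sigma>"
      unfolding column_query_def using x by blast
    ultimately show "?I x \<times> {snd x..<snd x + J} \<subseteq> S \<and> {fst x} \<times> {snd x + 1..snd x + J} \<subseteq> S"
      using S(2) by blast
  qed
  then show ?thesis unfolding fst_column_step_reached N[symmetric] .
qed

section \<open>Embedding the column exploration into one more dimension\<close>

definition column_vertex :: "nat \<Rightarrow> (nat \<Rightarrow> int) \<times> nat \<Rightarrow> nat \<Rightarrow> int" where
  "column_vertex d x = (fst x)(d := int (snd x))"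

text \<open>Every step of the exploration is a climb along the column of the parent followed by one
  sideways step; the climbs add up to the height \<open>snd x\<close>.\<close>

lemma column_vertex_wet:
  "x \<in> snd (column.run d J m (0, {(origin, 0)}) T) \<Longrightarrow>
    column_vertex d x \<in> wet (Suc d) (m + snd x) (column_vertex d ` T)"
proof (induction m arbitrary: x)
  case 0
  then show ?case by (auto simp: wet_0 column_vertex_def origin_def)
next
  case (Suc m)
  define \<sigma> where "\<sigma> = column.run d J m (0, {(origin, 0)}) T"
  obtain z h where x: "x = (z, h)" by (cases x)
  have "(z, h) \<in> snd (column_step d J \<sigma> T)"
    using Suc.prems unfolding \<sigma>_def x column.run_Suc_end .
  then obtain i where z: "z \<in> lattice_nbh d (fst ` snd \<sigma>)" "h = snd (parent d (snd \<sigma>) z) + i"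
      "column_hit d (snd \<sigma>) T z i"
    by (auto simp: column_step_mem column_first_def)
  obtain y b where yb: "parent d (snd \<sigma>) z = (y, b)" by (cases "parent d (snd \<sigma>) z")
  have y: "(y, b) \<in> snd \<sigma>" "z \<in> children d y" using parent[OF z(1)] yb by auto
  have col: "column_vertex d (y, b + j) \<in> wet (Suc d) (m + b + j) (column_vertex d ` T)" if "j \<le> i" for j
    using that
  proof (induction j)
    case 0
    then show ?case using Suc.IH[of "(y, b)"] y(1) by (simp add: \<sigma>_def)
  next
    case (Suc j)
    have "\<forall>j\<in>{1..i}. (y, b + j) \<in> T"
      using z(3) by (simp only: column_hit_def yb fst_conv snd_conv) blast
    then have "(y, b + Suc j) \<in> T" by (rule bspec) (use Suc.prems in auto)
    then have "column_vertex d (y, b + Suc j) \<in> column_vertex d ` T" by (rule imageI)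
    moreover have "column_vertex d (y, b + Suc j) = inc d (column_vertex d (y, b + j))"
      by (auto simp: column_vertex_def inc_def)
    ultimately show ?case using Suc by (auto simp: wet_Suc lattice_nbh_def)
  qed
  obtain k where k: "k < d" "z = inc k y" using y(2) by (auto simp: children_def)
  have "column_vertex d (z, b + i) = inc k (column_vertex d (y, b + i))"
    using k by (auto simp: column_vertex_def inc_def)
  moreover have "column_vertex d (z, b + i) \<in> column_vertex d ` T"
    using z(3) by (intro imageI) (auto simp: column_hit_def yb)
  ultimately show ?case
    using col[of i] k z(2) yb by (auto simp: x wet_Suc lattice_nbh_def add.assoc)
qed

lemma survival_column:
  assumes p: "0 \<le> p" "p \<le> 1" and r: "0 \<le> r" "r \<le> 1" "1 - p \<le> (1 - r) ^ d"
  shows "survival (lattice_nbh d) (column_prob p r J) m {origin} \<le> survival (lattice_nbh (Suc d)) p m {origin}"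
proof -
  let ?s = "\<lambda>m (\<sigma> :: column_state). survival (lattice_nbh d) (column_prob p r J) m (fst ` snd \<sigma>)"
  let ?F = "\<lambda>\<sigma> :: column_state. if snd \<sigma> = {} then 0 else (1::real)"
  let ?\<sigma> = "(0, {(origin, 0)}) :: column_state"
  let ?G = "\<lambda>T. if wet (Suc d) m T = {} then 0 else (1::real)"
  note a = column_prob_bounds[OF p r(1,2), of J]
  have inv: "column_inv d ?\<sigma>" by (simp add: column_inv_def origin_Zd level_origin)
  have "\<exists>R. finite R \<and> R \<subseteq> column_fresh d ?\<sigma> \<and>
    (\<forall>S. finite S \<longrightarrow> R \<subseteq> S \<longrightarrow> ?s m ?\<sigma> \<le> site_exp p S (\<lambda>T. ?F (column.run d J m ?\<sigma> T)))"
  proof (rule column.site_exp_run_ge[OF p _ _ inv])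
    fix m \<sigma> and S :: "((nat \<Rightarrow> int) \<times> nat) set"
    assume "column_inv d \<sigma>" "finite S" "column_query d J \<sigma> \<subseteq> S"
    then show "?s (Suc m) \<sigma> \<le> site_exp p S (\<lambda>T. ?s m (column_step d J \<sigma> T))"
      unfolding survival.simps using a
      by (intro column_survival_step p r finite_mono_survival growth_map_lattice_nbh) auto
  qed auto
  then obtain R where R: "finite R" "R \<subseteq> column_fresh d ?\<sigma>"
    "?s m ?\<sigma> \<le> site_exp p R (\<lambda>T. ?F (column.run d J m ?\<sigma> T))"
    by blast
  obtain R' where R': "finite R'" "\<And>S. finite S \<Longrightarrow> R' \<subseteq> S \<Longrightarrow>
      site_exp p S ?G = survival (lattice_nbh (Suc d)) p m {origin}"
    using site_exp_wet[OF p, of "Suc d" m] by blast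
  have inj: "inj_on (column_vertex d) R"
  proof (rule inj_onI)
    fix x x' assume x: "x \<in> R" "x' \<in> R" and eq: "column_vertex d x = column_vertex d x'"
    have "fst x d = 0" "fst x' d = 0" using x R(2) by (auto simp: column_fresh_def Zd_def)
    moreover have "int (snd x) = int (snd x')"
      using fun_cong[OF eq, of d] by (simp add: column_vertex_def)
    moreover have "fst x i = fst x' i" if "i \<noteq> d" for i
      using fun_cong[OF eq, of i] that by (simp add: column_vertex_def)
    ultimately show "x = x'" by (intro prod_eqI ext) (metis, simp)
  qed
  have G: "finite_mono ?G"
    unfolding finite_mono_def
  proof (intro allI impI)
    fix A B :: "(nat \<Rightarrow> int) set" assume "A \<subseteq> B"
    then have "wet (Suc d) m A \<subseteq> wet (Suc d) m B" by (rule wet_mono)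
    then show "?G A \<le> ?G B" by auto
  qed
  have "survival (lattice_nbh d) (column_prob p r J) m {origin} = ?s m ?\<sigma>" by simp
  also have "\<dots> \<le> site_exp p R (\<lambda>T. ?F (column.run d J m ?\<sigma> T))" by (rule R(3))
  also have "\<dots> \<le> site_exp p R (\<lambda>T. ?G (column_vertex d ` T))"
  proof (intro site_exp_mono p)
    fix T
    have "wet (Suc d) m (column_vertex d ` T) \<noteq> {}" if ne: "snd (column.run d J m ?\<sigma> T) \<noteq> {}"
    proof -
      obtain x where "x \<in> snd (column.run d J m ?\<sigma> T)"
        using ne by blast
      from column_vertex_wet[OF this] have "wet (Suc d) (m + snd x) (column_vertex d ` T) \<noteq> {}" by auto
      \<comment> \<open>The vertex found may lie above level \<open>m\<close>; the levels below it
        are then wet as well.\<close>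
      then show ?thesis using wet_empty_mono[of "Suc d" m "column_vertex d ` T" "m + snd x"] by auto
    qed
    then show "?F (column.run d J m ?\<sigma> T) \<le> ?G (column_vertex d ` T)" by auto
  qed
  also have "\<dots> = site_exp p (column_vertex d ` R) ?G"
    by (rule site_exp_image[OF R(1) inj, symmetric])
  also have "\<dots> \<le> site_exp p (column_vertex d ` R \<union> R') ?G"
    using R(1) R'(1) by (intro site_exp_mono_set p G) auto
  also have "\<dots> = survival (lattice_nbh (Suc d)) p m {origin}"
    using R(1) R'(1) by (intro R'(2)) auto
  finally show ?thesis .
qed

section \<open>Unbounded search depth and the equation of \<open>Sol\<close>\<close>

lemma column_prob_limit:
  assumes p: "0 < p" "p \<le> 1" and r: "0 \<le> r" "r \<le> 1"
  shows "column_prob p r \<longlonglongrightarrow> p / (1 - (1 - p) * r)"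
proof -
  define c where "c = (1 - p) * r"
  have c: "0 \<le> c" "c < 1"
    using p r mult_left_mono[of r 1 "1 - p"] by (auto simp: c_def)
  have eq: "column_prob p r J = p / (1 - c) * (1 - c ^ J)" for J
  proof (induction J)
    case (Suc J)
    have "column_prob p r (Suc J) = p + c * column_prob p r J"
      by (simp add: c_def algebra_simps)
    also have "\<dots> = p / (1 - c) * ((1 - c) + c * (1 - c ^ J))"
      unfolding Suc using c by (simp add: divide_simps) (simp add: algebra_simps)
    finally show ?case by (simp add: algebra_simps)
  qed simp
  have "(\<lambda>J. p / (1 - c) * (1 - c ^ J)) \<longlonglongrightarrow> p / (1 - c) * (1 - 0)"
    using c by (intro tendsto_intros LIMSEQ_power_zero) auto
  then show ?thesis by (simp add: eq[abs_def] c_def)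
qed

text \<open>Solutions are the zeros of \<open>?f\<close>, which is strictly increasing and changes
  sign on the unit interval.\<close>

lemma Sol_solution:
  assumes a: "0 < a" "a < 1" and b: "1 < b"
  shows "Sol a b \<in> {0<..<1}" "(1 - a) * Sol a b = a * (1 - Sol a b) powr b"
proof -
  let ?f = "\<lambda>x::real. (1 - a) * x - a * (1 - x) powr b"
  have mono: "?f x < ?f y" if "x < y" "y \<le> 1" for x y
    using that a b powr_less_mono2[of b "1 - y" "1 - x"] by (intro diff_strict_mono mult_strict_left_mono) auto
  have "continuous_on {0..1} ?f"
    using b by (intro continuous_intros continuous_on_powr') auto
  then obtain x where x: "0 \<le> x" "x \<le> 1" "?f x = 0"
    using IVT'[of ?f 0 0 1] a b by auto
  have "x \<noteq> 0" "x \<noteq> 1" using x(3) a b by auto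
  then have x': "x \<in> {0<..<1}" using x by auto
  have eq: "y = a * (y + (1 - y) powr b) \<longleftrightarrow> ?f y = 0" for y by (auto simp: algebra_simps)
  have "\<exists>!x. x \<in> {0<..<1} \<and> x = a * (x + (1 - x) powr b)"
  proof (rule ex1I[of _ x])
    show "x \<in> {0<..<1} \<and> x = a * (x + (1 - x) powr b)" using x' x(3) unfolding eq by blast
    show "y = x" if "y \<in> {0<..<1} \<and> y = a * (y + (1 - y) powr b)" for y
    proof -
      have y: "y \<in> {0<..<1}" "?f y = 0" using that unfolding eq by auto
      then show ?thesis using mono[of x y] mono[of y x] x(3) x' by (cases x y rule: linorder_cases) auto
    qed
  qed
  from theI'[OF this] have S: "Sol a b \<in> {0<..<1} \<and> Sol a b = a * (Sol a b + (1 - Sol a b) powr b)"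
    unfolding Sol_def[symmetric] .
  then have "?f (Sol a b) = 0" unfolding eq[symmetric] by blast
  then show "Sol a b \<in> {0<..<1}" "(1 - a) * Sol a b = a * (1 - Sol a b) powr b" using S by auto
qed

text \<open>Above \<open>Sol\<close> the limit of \<open>column_prob\<close> exceeds
  \<open>pc_site d\<close>, so some finite depth already makes the projected process
  supercritical.\<close>

lemma pc_site_Suc:
  assumes d: "d \<ge> 1" and c1: "pc_site d < 1"
  shows "pc_site (Suc d) \<le> Sol (pc_site d) (real (d + 1) / real d)"
proof (rule pc_site_le)
  define c where "c = pc_site d"
  define b where "b = real (d + 1) / real d"
  have c: "0 < c" "c < 1" using pc_site_pos[OF d] c1 by (auto simp: c_def)
  have b: "1 < b" "b = 1 + 1 / real d" using d by (auto simp: b_def field_simps)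
  note sol = Sol_solution[OF c b(1)]
  fix p assume "Sol (pc_site d) (real (d + 1) / real d) < p" "0 \<le> p" "p \<le> 1"
  then have p: "Sol c b < p" "p \<le> 1" "0 < p" using sol(1) by (auto simp: c_def b_def)
  define r where "r = 1 - (1 - p) powr (1 / real d)"
  have r: "0 \<le> r" "r \<le> 1" using p d powr_le1[of "1 / real d" "1 - p"] by (auto simp: r_def)
  have rd: "1 - p \<le> (1 - r) ^ d"
  proof (cases "p = 1")
    case False
    then have "((1 - p) powr (1 / real d)) ^ d = 1 - p"
      using p d by (simp flip: powr_realpow add: powr_powr)
    then show ?thesis by (simp add: r_def)
  qed (use d in \<open>auto simp: r_def\<close>)
  have pb: "(1 - p) powr b = (1 - p) * (1 - p) powr (1 / real d)"
    using p unfolding b(2) powr_add by simp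
  have "c * (1 - p) powr b < (1 - c) * p"
  proof -
    have "c * (1 - p) powr b \<le> c * (1 - Sol c b) powr b"
      using c p b by (intro mult_left_mono powr_mono2) auto
    also have "\<dots> = (1 - c) * Sol c b" using sol(2) by simp
    also have "\<dots> < (1 - c) * p" using c p by (intro mult_strict_left_mono) auto
    finally show ?thesis .
  qed
  then have "c * (p + (1 - p) powr b) < p" by (simp add: algebra_simps)
  moreover have den: "1 - (1 - p) * r = p + (1 - p) powr b"
    unfolding pb r_def by (simp add: algebra_simps)
  moreover have "0 < p + (1 - p) powr b" using p by (simp add: add_pos_nonneg)
  ultimately have "c < p / (1 - (1 - p) * r)" by (simp add: pos_less_divide_eq)
  from order_tendstoD(1)[OF column_prob_limit[OF p(3,2) r] this]
  obtain J where J: "c < column_prob p r J" by (auto simp: eventually_sequentially)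
  define a where "a = column_prob p r J"
  have a: "0 \<le> a" "a \<le> 1" "c < a" using column_prob_bounds[of p r J] p r J by (auto simp: a_def)
  then have "theta_site d a \<noteq> 0" using le_pc_site[of a d] by (auto simp: c_def)
  then have pos: "0 < theta_site d a" using theta_site_nonneg[of d a] by linarith
  have "theta_site d a \<le> survival (lattice_nbh (Suc d)) p m {origin}" for m
  proof -
    have "0 \<le> survival (lattice_nbh d) a m {origin}"
      using survival_bounds[OF growth_map_lattice_nbh a(1,2), of "{origin}"] by auto
    then have "theta_site d a \<le> survival (lattice_nbh d) a m {origin}"
      using theta_site_limit(2)[OF a(1,2), of d m] mult_left_le_one_le[of _ a] a by (meson order_trans)
    also have "\<dots> \<le> survival (lattice_nbh (Suc d)) p m {origin}"
      unfolding a_def using p r rd by (intro survival_column) auto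
    finally show ?thesis .
  qed
  from theta_site_pos[OF p(3,2) pos this] show "theta_site (Suc d) p \<noteq> 0" by simp
qed

text \<open>This is what gives \<open>Sol (pc_site d)\<close> a meaning. The plane has the bound 3/4
  from the even case, and a value of \<open>Sol\<close> is again below 1.\<close>

lemma pc_site_less_1: "d \<ge> 2 \<Longrightarrow> pc_site d < 1"
proof (induction d rule: dec_induct)
  case base
  have "pc_site 2 \<le> 1 - (1 / 4) powr (2 / real 2)" by (rule pc_site_even) auto
  then show ?case by simp
next
  case (step d)
  have "pc_site (Suc d) \<le> Sol (pc_site d) (real (d + 1) / real d)"
    using step by (intro pc_site_Suc) auto
  also have "\<dots> < 1"
    using step pc_site_pos[of d] Sol_solution(1)[of "pc_site d" "real (d + 1) / real d"] by (auto simp: field_simps)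
  finally show ?case .
qed

theorem theorem2p4:
  shows "(\<forall>d::nat. d \<ge> 1 \<and> even d \<longrightarrow> pc_site d \<le> 1 - (1/4) powr (2 / real d)) \<and>
         (\<forall>d::nat. d \<ge> 2 \<longrightarrow> pc_site (d + 1) \<le> Sol (pc_site d) (real (d + 1) / real d))"
  using pc_site_even pc_site_Suc pc_site_less_1 by auto

end
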